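(* Provable judgments of the relational Hoare logic are valid: for all programs $P_1,P_2$, every handler contract $(I_P,I_Q)$, and all families $\Phi=(\Phi_{f,g})$, $\Psi=(\Psi_{f,g})$ of relations on states (indexed by functions $f\in P_1$, $g\in P_2$), $$I_P,I_Q\vdash P_1\sim P_2:\Phi\Rightarrow\Psi\quad\text{implies}\quad I_P,I_Q\models P_1\sim P_2:\Phi\Rightarrow\Psi .$$
   Context: Interaction trees. $\mathsf{itree}\ \mathsf{E}\ \mathsf{R}$ is the coinductive type $t::=\mathsf{Ret}(r)\mid\mathsf{Tau}(t)\mid\mathsf{Vis}(e,k)$ with $r:\mathsf{R}$, $e:\mathsf{E}\,\mathsf{A}$, $k:\mathsf{A}\to\mathsf{itree}\ \mathsf{E}\ \mathsf{R}$. "$x\leftarrow t;k$" is monadic bind, $\mathsf{trigger}(e)=\mathsf{Vis}(e,x\mapsto\mathsf{Ret}(x))$, $+'$ is disjoint union of event families. $\mathsf{iter}(\mathit{body})(i)$ repeatedly runs $\mathit{body}:I\to\mathsf{itree}\ \mathsf{E}\ (I+A)$, continuing on $\mathsf{inl}$ and returning on $\mathsf{inr}$. $\mathsf{interp\_mrec}(H,t)$, for $H$ mapping events of $\mathsf{E}'$ to trees over $\mathsf{E}'+'\mathsf{E}$, recursively replaces all $\mathsf{E}'$ events of $t$ (including those produced by $H$) using $H$, giving a tree over $\mathsf{E}$. $\approx$ is weak bisimilarity (equality of trees up to finitely many $\mathsf{Tau}$s at each point). Language. Commands: $c::=\mathbf{skip}\mid\ell:=e\mid\ell:=\mathbf{rand}(e)\mid\ell:=f(e)\mid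 c;c\mid\mathbf{if}(e)\{c\}\{c\}\mid\mathbf{while}(e)\{c\}$, where $e$ ranges over expressions and $\ell$ over left-values. A state $\sigma\in\mathsf{S}$ is a pair of a memory $\sigma_m$ and a variable map $\sigma_r:\mathsf{Var}\to\mathsf{Val}$. Expression evaluation $(\!|e|\!)_\sigma:\mathsf{itree}\ \mathsf{Err}\ \mathsf{Val}$ and left-value writing $(\!|\ell\leftarrow v|\!)_\sigma:\mathsf{itree}\ \mathsf{Err}\ \mathsf{S}$ are given (standard; errors are $\mathsf{Err}$ events). A program is a collection of functions $f$, each with argument $f_{arg}$, body $f_{body}$ (a command) and result $f_{res}$. Semantics. The call semantics $(\!|c|\!)^\star_\sigma:\mathsf{itree}\ (\mathsf{Call}+'\mathsf{Err}+'\mathsf{Rnd})\ \mathsf{S}$ is: $\mathbf{skip}$: $\mathsf{Ret}(\sigma)$; $\ell:=e$: $v\leftarrow(\!|e|\!)_\sigma;(\!|\ell\leftarrow v|\!)_\sigma$; $\ell:=\mathbf{rand}(e)$: $n\leftarrow(\!|e|\!)_\sigma;a\leftarrow\mathsf{trigger}(\mathsf{Rnd}(n));(\!|\ell\leftarrow a|\!)_\sigma$ (answers of $\mathsf{Rnd}(n)$ are strings of $n$ bytes); $c;c'$: $\sigma'\leftarrow(\!|c|\!)^\star_\sigma;(\!|c'|\!)^\star_{\sigma'}$; $\mathbf{if}(e)\{c_\top\}\{c_\bot\}$: $b\leftarrow(\!|e|\!)_\sigma;(\!|c_b|\!)^\star_\sigma$; $\mathbf{while}(e)\{c\}$: $\mathsf{iter}$,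 at $\sigma$, of the body that evaluates $e$ to $b$ and, if $b$, runs $c$ to $\sigma'$ and returns $\mathsf{inl}(\sigma')$, else returns $\mathsf{inr}(\sigma)$; $\ell:=f(e)$: $v\leftarrow(\!|e|\!)_\sigma;(m',v')\leftarrow\mathsf{trigger}(\mathsf{Call}(f,\sigma_m,v));(\!|\ell\leftarrow v'|\!)_{(m',\sigma_r)}$. The interprocedural semantics for a program is $(\!|c|\!)_\sigma=\mathsf{interp\_mrec}(H^c,(\!|c|\!)^\star_\sigma):\mathsf{itree}\ (\mathsf{Err}+'\mathsf{Rnd})\ \mathsf{S}$ with $H^c(\mathsf{Call}(f,m,v))=\sigma\leftarrow(\!|f_{body}|\!)^\star_{(m,\{f_{arg}\mapsto v\})};\mathsf{Ret}(\sigma_m,\sigma_r(f_{res}))$. Handler contracts. A contract is a pair of an event precondition $I_P$, relating events $e_1:\mathsf{E}_1\mathsf{A}_1$ and $e_2:\mathsf{E}_2\mathsf{A}_2$, and an event postcondition $I_Q$, relating pairs $(e_1,a_1)$ and $(e_2,a_2)$ of events with answers. In program judgments the events are those of $\mathsf{Err}+'\mathsf{Rnd}$; in command judgments those of $\mathsf{Call}+'\mathsf{Err}+'\mathsf{Rnd}$. Equivalence up-to-cutoff. $t_1\overset{u}{\approx}_{I_P,I_Q,\phi}t_2$ is the coinductive-inductive relation with rules: (Ret) $\mathsf{Ret}(r_1)\overset u\approx\mathsf{Ret}(r_2)$ if $r_1\phi r_2$; (Tau, coinductive) $\mathsf{Tau}(t_1)\overset u\approx\mathsf{Tau}(t_2)$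 if $t_1\overset u\approx t_2$; (Tau$_L$, Tau$_R$, inductive) $\mathsf{Tau}(t_1)\overset u\approx t_2$, resp. $t_1\overset u\approx\mathsf{Tau}(t_2)$, if $t_1\overset u\approx t_2$; (Vis, coinductive) $\mathsf{Vis}(e_1,k_1)\overset u\approx\mathsf{Vis}(e_2,k_2)$ if $e_1I_Pe_2$ and for all $a_1,a_2$ with $(e_1,a_1)I_Q(e_2,a_2)$, $k_1(a_1)\overset u\approx k_2(a_2)$; (Cut$_L$) $\mathsf{Vis}(e_1,k_1)\overset u\approx t_2$ for any $t_2$ if $e_1$ is a cutoff event on the left; (Cut$_R$) $t_1\overset u\approx\mathsf{Vis}(e_2,k_2)$ for any $t_1$ if $e_2$ is a cutoff event on the right. In the judgments below the left cutoff events are the $\mathsf{Err}$ events (undefined behavior of the left program) and there are no right cutoff events. Validity. $I_P,I_Q\models P_1\sim P_2:\Phi\Rightarrow\Psi$ iff for all functions $f\in P_1$, $g\in P_2$ and states with $\sigma_1\Phi_{f,g}\sigma_2$: $(\!|f_{body}|\!)_{\sigma_1}\overset u\approx_{I_P,I_Q,\Psi_{f,g}}(\!|g_{body}|\!)_{\sigma_2}$ (interprocedural semantics in $P_1$, resp. $P_2$). For expressions, $\models e_1\sim e_2:\Phi\Rightarrow\psi$ ($\psi$ a relation on values) means that evaluating $e_1$ and $e_2$ in $\Phi$-related states $\sigma_1,\sigma_2$ yields $\psi$-related values, in the sense that $(\!|e_1|\!)_{\sigma_1}\overset u\approx(\!|e_2|\!)_{\sigma_2}$ with result relation $\psi$.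 For left-values, $\models\ell_1\sim\ell_2:\Phi/\phi\Rightarrow\Psi$ means that writing $\phi$-related values $v_1,v_2$ to $\Phi$-related states $\sigma_1,\sigma_2$ yields $\Psi$-related states, in the sense that $(\!|\ell_1\leftarrow v_1|\!)_{\sigma_1}\overset u\approx(\!|\ell_2\leftarrow v_2|\!)_{\sigma_2}$ with result relation $\Psi$. Proof rules. Command judgments $I_P,I_Q\vdash c_1\sim c_2:\Phi\Rightarrow\Psi$ ($\Phi,\Psi$ relations on states; contract fixed and omitted unless indicated; "$\Phi\wedge e_1$" means $\Phi$ and $e_1$ is true in the left state) are generated by: - Skip: $\vdash\mathbf{skip}\sim\mathbf{skip}:\Phi\Rightarrow\Phi$. - Seq: from $\vdash c_1\sim c_2:\Phi\Rightarrow\Phi'$ and $\vdash c_1'\sim c_2':\Phi'\Rightarrow\Phi''$ infer $\vdash c_1;c_1'\sim c_2;c_2':\Phi\Rightarrow\Phi''$. - Assign: from $\models e_1\sim e_2:\Phi\Rightarrow\phi$ and $\models\ell_1\sim\ell_2:\Phi/\phi\Rightarrow\Psi$ infer $\vdash\ell_1:=e_1\sim\ell_2:=e_2:\Phi\Rightarrow\Psi$. - Case: from $\models e_1\sim e_2:\Phi\Rightarrow{=}$, $\vdash c_1\sim c_2:\Phi\wedge e_1\Rightarrow\Psi$, $\vdash c_1'\sim c_2':\Phi\wedge\neg e_1\Rightarrow\Psi$ infer $\vdash\mathbf{if}(e_1)\{c_1\}\{c_1'\}\sim\mathbf{if}(e_2)\{c_2\}\{c_2'\}:\Phi\Rightarrow\Psi$.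 - While: from $\models e_1\sim e_2:\Phi\Rightarrow{=}$ and $\vdash c_1\sim c_2:\Phi\wedge e_1\Rightarrow\Phi$ infer $\vdash\mathbf{while}(e_1)\{c_1\}\sim\mathbf{while}(e_2)\{c_2\}:\Phi\Rightarrow\Phi\wedge\neg e_1$. - Rand: from $\models e_1\sim e_2:\Phi\Rightarrow I_P$ and $\models\ell_1\sim\ell_2:\Phi/I_Q\Rightarrow\Psi$ infer $\vdash\ell_1:=\mathbf{rand}(e_1)\sim\ell_2:=\mathbf{rand}(e_2):\Phi\Rightarrow\Psi$, where $I_P$ is read as a relation on the sizes $n_1,n_2$ through the events $\mathsf{Rnd}(n_1),\mathsf{Rnd}(n_2)$ and $I_Q$ as a relation on the answers to these events. - Call: the contract for calls to $f$ and $g$ is split into relations on memories and on values, $I_P$ into $I_P^m$ and $I_P^v$, and $I_Q$ into $I_Q^m$ and $I_Q^v$. Let $\Phi_r$ be a relation on variable maps. From $\models e_1\sim e_2:(\Phi_r\wedge I_P^m)\Rightarrow I_P^v$ and $\models\ell_1\sim\ell_2:(\Phi_r\wedge I_Q^m)/I_Q^v\Rightarrow\Psi$ infer $\vdash\ell_1:=f(e_1)\sim\ell_2:=g(e_2):(\Phi_r\wedge I_P^m)\Rightarrow\Psi$. - Assign$_L$: if for all $\sigma_1,\sigma_1',\sigma_2$, $\sigma_1\Phi\sigma_2$ and $(\!|\ell:=e|\!)^\star_{\sigma_1}\approx\mathsf{Ret}(\sigma_1')$ imply $\sigma_1'\Psi\sigma_2$, infer $\vdash\ell:=e\sim\mathbf{skip}:\Phi\Rightarrow\Psi$.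 - Conseq: from $I_P',I_Q'\vdash c_1\sim c_2:\Phi'\Rightarrow\Psi'$ with $\Phi\Rightarrow\Phi'$, $\Psi'\Rightarrow\Psi$, $I_P'\Rightarrow I_P$, $I_Q\Rightarrow I_Q'$ infer $I_P,I_Q\vdash c_1\sim c_2:\Phi\Rightarrow\Psi$. - Trans: from $I_{P,1},I_{Q,1}\vdash c_1\sim c_2:\Phi_1\Rightarrow\Psi_1$ and $I_{P,2},I_{Q,2}\vdash c_2\sim c_3:\Phi_2\Rightarrow\Psi_2$ infer $I_{P,1}\circ I_{P,2},\ I_{Q,1}\circ I_{Q,2}\vdash c_1\sim c_3:\Phi_1\circ\Phi_2\Rightarrow\Psi_1\circ\Psi_2$, where $\circ$ is composition of relations: $x(R\circ R')z$ iff $\exists y.\ xRy\wedge yR'z$. Program judgments are derived by the rule Rec: if $I_P\cup\Phi,\ I_Q\cup\Psi\vdash f_{body}\sim g_{body}:\Phi_{f,g}\Rightarrow\Psi_{f,g}$ for every $f\in P_1$ and $g\in P_2$, then $I_P,I_Q\vdash P_1\sim P_2:\Phi\Rightarrow\Psi$. Here the contract $I_P\cup\Phi$, $I_Q\cup\Psi$ relates $\mathsf{Call}$ events using $\Phi$ and $\Psi$, and other events using $I_P$ and $I_Q$: $\mathsf{Call}(f,m_1,v_1)$ and $\mathsf{Call}(g,m_2,v_2)$ are related iff $(m_1,\{f_{arg}\mapsto v_1\})\,\Phi_{f,g}\,(m_2,\{g_{arg}\mapsto v_2\})$, and their answers $(m_1',v_1')$, $(m_2',v_2')$ are related iff there are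 states $\sigma_1'\Psi_{f,g}\sigma_2'$ with $m_1'=(\sigma_1')_m$, $v_1'=(\sigma_1')_r(f_{res})$, $m_2'=(\sigma_2')_m$, $v_2'=(\sigma_2')_r(g_{res})$.
   Formalization: Evaluation and left-value writing are assumed to halt (otherwise Assign_L is unsound). In Trans, I_Q is composed on answers: each middle event related by I_{P,1} and I_{P,2} must have a linking answer; the literal composition via any event-answer pair is unsound. *)

theory Defs
  imports Main "HOL-Library.Word"
begin

section \<open>Interaction trees\<close>

text \<open>
  HOL has no type-indexed event families. A family is rendered by a type \<open>'e\<close> of events, a type
  \<open>'a\<close> containing the answers to all of them, and a function \<open>'e \<Rightarrow> 'a set\<close> giving the
  answers to each single event. Continuations are total on \<open>'a\<close>; everything below that
  quantifies over answers to \<open>e\<close> is restricted to the answer set of \<open>e\<close>. The disjoint union of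
  two families is the sum of the event types together with the sum of the answer types.
\<close>

codatatype ('e, 'a, 'r) itree =
    Ret 'r
  | Tau "('e, 'a, 'r) itree"
  | Vis 'e "'a \<Rightarrow> ('e, 'a, 'r) itree"

fun sum_answers :: "('e1 \<Rightarrow> 'a1 set) \<Rightarrow> ('e2 \<Rightarrow> 'a2 set) \<Rightarrow> 'e1 + 'e2 \<Rightarrow> ('a1 + 'a2) set" where
  "sum_answers A1 A2 (Inl e) = Inl ` A1 e"
| "sum_answers A1 A2 (Inr e) = Inr ` A2 e"

primcorec bind ::
  "('e, 'a, 'r) itree \<Rightarrow> ('r \<Rightarrow> ('e, 'a, 's) itree) \<Rightarrow> ('e, 'a, 's) itree" where
  "bind t k = (case t of
      Ret r \<Rightarrow> (case k r of Ret s \<Rightarrow> Ret s | Tau u \<Rightarrow> Tau u | Vis e h \<Rightarrow> Vis e h)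
    | Tau u \<Rightarrow> Tau (bind u k)
    | Vis e h \<Rightarrow> Vis e (\<lambda>a. bind (h a) k))"

lemma bind_simps [simp]:
  "bind (Ret r) k = k r"
  "bind (Tau t) k = Tau (bind t k)"
  "bind (Vis e h) k = Vis e (\<lambda>a. bind (h a) k)"
  by (subst bind.code, simp split: itree.split)+

definition trigger :: "'e \<Rightarrow> ('e, 'a, 'a) itree" where
  "trigger e = Vis e Ret"

primcorec run_iter ::
  "('i \<Rightarrow> ('e, 'a, 'i + 'r) itree) \<Rightarrow> ('e, 'a, 'i + 'r) itree \<Rightarrow> ('e, 'a, 'r) itree" where
  "run_iter body t = (case t of
      Ret x \<Rightarrow> (case x of Inl i \<Rightarrow> Tau (run_iter body (body i)) | Inr r \<Rightarrow> Ret r)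
    | Tau u \<Rightarrow> Tau (run_iter body u)
    | Vis e h \<Rightarrow> Vis e (\<lambda>a. run_iter body (h a)))"

definition iter :: "('i \<Rightarrow> ('e, 'a, 'i + 'r) itree) \<Rightarrow> 'i \<Rightarrow> ('e, 'a, 'r) itree" where
  "iter body i = run_iter body (body i)"

lemma run_iter_simps:
  "run_iter body (Ret x) = (case x of Inl i \<Rightarrow> Tau (iter body i) | Inr r \<Rightarrow> Ret r)"
  "run_iter body (Tau t) = Tau (run_iter body t)"
  "run_iter body (Vis e h) = Vis e (\<lambda>a. run_iter body (h a))"
  by (subst run_iter.code; simp add: iter_def split: sum.split)+

lemma iter_unfold:
  "iter body i = bind (body i) (case_sum (\<lambda>j. Tau (iter body j)) Ret)"
proof -
  have "run_iter body t = bind t (case_sum (\<lambda>j. Tau (iter body j)) Ret)" for t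
  proof (coinduction arbitrary: t rule: itree.coinduct_strong)
    case Eq_itree
    show ?case
    proof (cases t)
      case (Ret x)
      then show ?thesis
        by (cases x) (simp_all add: run_iter_simps)
    next
      case (Tau u)
      then show ?thesis
        by (simp add: run_iter_simps) blast
    next
      case (Vis e h)
      then show ?thesis
        by (simp add: run_iter_simps rel_fun_def) blast
    qed
  qed
  then show ?thesis
    by (subst iter_def)
qed

primcorec interp_mrec ::
  "('e1 \<Rightarrow> ('e1 + 'e2, 'a1 + 'a2, 'a1) itree) \<Rightarrow> ('e1 + 'e2, 'a1 + 'a2, 'r) itree
     \<Rightarrow> ('e2, 'a2, 'r) itree" where
  "interp_mrec H t = (case t of
      Ret r \<Rightarrow> Ret r
    | Tau u \<Rightarrow> Tau (interp_mrec H u)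
    | Vis e h \<Rightarrow> (case e of
          Inl e1 \<Rightarrow> Tau (interp_mrec H (bind (H e1) (\<lambda>a. h (Inl a))))
        | Inr e2 \<Rightarrow> Vis e2 (\<lambda>a. interp_mrec H (h (Inr a)))))"

text \<open>Embedding of trees over one family into trees over a larger one.\<close>

primcorec embed ::
  "('e \<Rightarrow> 'e2) \<Rightarrow> ('a2 \<Rightarrow> 'a) \<Rightarrow> ('e, 'a, 'r) itree \<Rightarrow> ('e2, 'a2, 'r) itree" where
  "embed ev an t = (case t of
      Ret r \<Rightarrow> Ret r
    | Tau u \<Rightarrow> Tau (embed ev an u)
    | Vis e h \<Rightarrow> Vis (ev e) (\<lambda>a. embed ev an (h (an a))))"


section \<open>Handler contracts and equivalence up-to-cutoff\<close>

type_synonym ('e1, 'e2) epre = "'e1 \<Rightarrow> 'e2 \<Rightarrow> bool"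
type_synonym ('e1, 'a1, 'e2, 'a2) epost = "'e1 \<times> 'a1 \<Rightarrow> 'e2 \<times> 'a2 \<Rightarrow> bool"

inductive eqcut_step ::
  "('e1 \<Rightarrow> 'a1 set) \<Rightarrow> ('e2 \<Rightarrow> 'a2 set) \<Rightarrow> ('e1 \<Rightarrow> bool) \<Rightarrow> ('e2 \<Rightarrow> bool)
     \<Rightarrow> ('e1, 'e2) epre \<Rightarrow> ('e1, 'a1, 'e2, 'a2) epost \<Rightarrow> ('r1 \<Rightarrow> 'r2 \<Rightarrow> bool)
     \<Rightarrow> (('e1, 'a1, 'r1) itree \<Rightarrow> ('e2, 'a2, 'r2) itree \<Rightarrow> bool)
     \<Rightarrow> ('e1, 'a1, 'r1) itree \<Rightarrow> ('e2, 'a2, 'r2) itree \<Rightarrow> bool"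
  for A1 A2 cutL cutR IP IQ \<phi> X where
  Ret: "\<phi> r1 r2 \<Longrightarrow> eqcut_step A1 A2 cutL cutR IP IQ \<phi> X (Ret r1) (Ret r2)"
| Tau: "X t1 t2 \<Longrightarrow> eqcut_step A1 A2 cutL cutR IP IQ \<phi> X (Tau t1) (Tau t2)"
| TauL: "eqcut_step A1 A2 cutL cutR IP IQ \<phi> X t1 t2
    \<Longrightarrow> eqcut_step A1 A2 cutL cutR IP IQ \<phi> X (Tau t1) t2"
| TauR: "eqcut_step A1 A2 cutL cutR IP IQ \<phi> X t1 t2
    \<Longrightarrow> eqcut_step A1 A2 cutL cutR IP IQ \<phi> X t1 (Tau t2)"
| Vis: "IP e1 e2
    \<Longrightarrow> (\<And>a1 a2. a1 \<in> A1 e1 \<Longrightarrow> a2 \<in> A2 e2 \<Longrightarrow> IQ (e1, a1) (e2, a2) \<Longrightarrow> X (k1 a1) (k2 a2))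
    \<Longrightarrow> eqcut_step A1 A2 cutL cutR IP IQ \<phi> X (Vis e1 k1) (Vis e2 k2)"
| CutL: "cutL e1 \<Longrightarrow> eqcut_step A1 A2 cutL cutR IP IQ \<phi> X (Vis e1 k1) t2"
| CutR: "cutR e2 \<Longrightarrow> eqcut_step A1 A2 cutL cutR IP IQ \<phi> X t1 (Vis e2 k2)"

lemma eqcut_step_mono [mono]:
  assumes "\<And>t1 t2. X t1 t2 \<longrightarrow> Y t1 t2"
  shows "eqcut_step A1 A2 cutL cutR IP IQ \<phi> X t1 t2 \<longrightarrow> eqcut_step A1 A2 cutL cutR IP IQ \<phi> Y t1 t2"
proof
  assume "eqcut_step A1 A2 cutL cutR IP IQ \<phi> X t1 t2"
  then show "eqcut_step A1 A2 cutL cutR IP IQ \<phi> Y t1 t2"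
    by induction (use assms in \<open>auto intro: eqcut_step.intros\<close>)
qed

coinductive eqcut ::
  "('e1 \<Rightarrow> 'a1 set) \<Rightarrow> ('e2 \<Rightarrow> 'a2 set) \<Rightarrow> ('e1 \<Rightarrow> bool) \<Rightarrow> ('e2 \<Rightarrow> bool)
     \<Rightarrow> ('e1, 'e2) epre \<Rightarrow> ('e1, 'a1, 'e2, 'a2) epost \<Rightarrow> ('r1 \<Rightarrow> 'r2 \<Rightarrow> bool)
     \<Rightarrow> ('e1, 'a1, 'r1) itree \<Rightarrow> ('e2, 'a2, 'r2) itree \<Rightarrow> bool"
  for A1 A2 cutL cutR IP IQ \<phi> where
  "eqcut_step A1 A2 cutL cutR IP IQ \<phi> (eqcut A1 A2 cutL cutR IP IQ \<phi>) t1 t2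
    \<Longrightarrow> eqcut A1 A2 cutL cutR IP IQ \<phi> t1 t2"

text \<open>Weak bisimilarity is the instance with equalities everywhere and no cutoff.\<close>

definition weak_bisim ::
  "('e \<Rightarrow> 'a set) \<Rightarrow> ('e, 'a, 'r) itree \<Rightarrow> ('e, 'a, 'r) itree \<Rightarrow> bool" where
  "weak_bisim A = eqcut A A (\<lambda>_. False) (\<lambda>_. False) (=) (=) (=)"


section \<open>Language\<close>

type_synonym byte = "8 word"

datatype ('expr, 'lval, 'f) cmd =
    Skip
  | Assign 'lval 'expr
  | Rand 'lval 'expr
  | Call 'lval 'f 'expr
  | Seq "('expr, 'lval, 'f) cmd" "('expr, 'lval, 'f) cmd"
  | If 'expr "('expr, 'lval, 'f) cmd" "('expr, 'lval, 'f) cmd"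
  | While 'expr "('expr, 'lval, 'f) cmd"

type_synonym ('mem, 'var, 'val) state = "'mem \<times> ('var \<Rightarrow> 'val)"

text \<open>
  Event families: \<open>Call(f, m, v)\<close> is the triple \<open>(f, m, v)\<close>, answered by a memory and a value;
  \<open>Rnd(n)\<close> is the number \<open>n\<close>, answered by a string of \<open>n\<close> bytes; an event of \<open>Err\<close> is an element
  of \<open>'err\<close> and has no answers (\<open>unit\<close> only serves as carrier of the empty answer set).
\<close>

type_synonym 'err ext_event = "'err + nat"
type_synonym ext_answer = "unit + byte list"
type_synonym ('f, 'mem, 'val, 'err) cmd_event = "('f \<times> 'mem \<times> 'val) + 'err ext_event"
type_synonym ('mem, 'val) cmd_answer = "('mem \<times> 'val) + ext_answer"

abbreviation CallE :: "'f \<Rightarrow> 'mem \<Rightarrow> 'val \<Rightarrow> ('f, 'mem, 'val, 'err) cmd_event" where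
  "CallE f m v \<equiv> Inl (f, m, v)"

abbreviation ErrE :: "'err \<Rightarrow> ('f, 'mem, 'val, 'err) cmd_event" where
  "ErrE x \<equiv> Inr (Inl x)"

abbreviation RndE :: "nat \<Rightarrow> ('f, 'mem, 'val, 'err) cmd_event" where
  "RndE n \<equiv> Inr (Inr n)"

abbreviation CallA :: "'mem \<Rightarrow> 'val \<Rightarrow> ('mem, 'val) cmd_answer" where
  "CallA m v \<equiv> Inl (m, v)"

abbreviation RndA :: "byte list \<Rightarrow> ('mem, 'val) cmd_answer" where
  "RndA a \<equiv> Inr (Inr a)"

definition call_answers :: "'f \<times> 'mem \<times> 'val \<Rightarrow> ('mem \<times> 'val) set" where
  "call_answers e = UNIV"

definition err_answers :: "'err \<Rightarrow> unit set" where
  "err_answers e = {}"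

definition rnd_answers :: "nat \<Rightarrow> byte list set" where
  "rnd_answers n = {a. length a = n}"

definition ext_answers :: "'err ext_event \<Rightarrow> ext_answer set" where
  "ext_answers = sum_answers err_answers rnd_answers"

definition cmd_answers ::
  "('f, 'mem, 'val, 'err) cmd_event \<Rightarrow> ('mem, 'val) cmd_answer set" where
  "cmd_answers = sum_answers call_answers ext_answers"

type_synonym ('err, 'r) err_tree = "('err, unit, 'r) itree"
type_synonym ('err, 'r) ext_tree = "('err ext_event, ext_answer, 'r) itree"
type_synonym ('f, 'mem, 'val, 'err, 'r) cmd_tree =
  "(('f, 'mem, 'val, 'err) cmd_event, ('mem, 'val) cmd_answer, 'r) itree"

text \<open>
  The given ingredients of the language. Guards, sizes and random strings are particular values:
  \<open>val_bool\<close> and \<open>val_size\<close> read a value as a truth value or as a size, \<open>bytes_val\<close> is the value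
  of a byte string, and \<open>type_err\<close> is the error raised when a value cannot be read as required.
  \<open>call_err\<close> is the error raised by a call to a function which the program does not contain.
  \<open>init_val\<close> is the content of the variables other than \<open>f_arg\<close> in \<open>{f_arg \<mapsto> v}\<close>.
\<close>

record ('expr, 'lval, 'mem, 'var, 'val, 'err) lang =
  eval :: "'expr \<Rightarrow> ('mem, 'var, 'val) state \<Rightarrow> ('err, 'val) err_tree"
  put :: "'lval \<Rightarrow> 'val \<Rightarrow> ('mem, 'var, 'val) state \<Rightarrow> ('err, ('mem, 'var, 'val) state) err_tree"
  val_bool :: "'val \<Rightarrow> bool option"
  val_size :: "'val \<Rightarrow> nat option"
  bytes_val :: "byte list \<Rightarrow> 'val"
  type_err :: 'err
  call_err :: 'err
  init_val :: 'val

text \<open>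
  Evaluating an expression or writing a left-value takes finitely many steps: it ends with a
  result or with an error. Without this the rule for a one-sided assignment would relate a
  diverging assignment to \<open>Skip\<close> under every postcondition.
\<close>

inductive halts :: "('e, 'a, 'r) itree \<Rightarrow> bool" where
  "halts (Ret r)"
| "halts (Vis e k)"
| "halts t \<Longrightarrow> halts (Tau t)"

definition halting_lang :: "('expr, 'lval, 'mem, 'var, 'val, 'err) lang \<Rightarrow> bool" where
  "halting_lang L \<longleftrightarrow> (\<forall>e \<sigma>. halts (eval L e \<sigma>)) \<and> (\<forall>l v \<sigma>. halts (put L l v \<sigma>))"

record ('expr, 'lval, 'f, 'var) func =
  f_arg :: 'var
  f_body :: "('expr, 'lval, 'f) cmd"
  f_res :: 'var

type_synonym ('expr, 'lval, 'f, 'var) program = "'f \<Rightarrow> ('expr, 'lval, 'f, 'var) func option"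


section \<open>Semantics\<close>

definition throw :: "'err \<Rightarrow> ('err, 'r) err_tree" where
  "throw x = Vis x (\<lambda>_. undefined)"

definition val_of_option :: "'err \<Rightarrow> 'r option \<Rightarrow> ('err, 'r) err_tree" where
  "val_of_option x o' = (case o' of Some r \<Rightarrow> Ret r | None \<Rightarrow> throw x)"

definition lift_err :: "('err, 'r) err_tree \<Rightarrow> ('f, 'mem, 'val, 'err, 'r) cmd_tree" where
  "lift_err = embed ErrE (\<lambda>_. ())"

definition trigger_rnd :: "nat \<Rightarrow> ('f, 'mem, 'val, 'err, byte list) cmd_tree" where
  "trigger_rnd n = bind (trigger (RndE n)) (\<lambda>a. Ret (projr (projr a)))"

definition trigger_call ::
  "'f \<Rightarrow> 'mem \<Rightarrow> 'val \<Rightarrow> ('f, 'mem, 'val, 'err, 'mem \<times> 'val) cmd_tree" where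
  "trigger_call f m v = bind (trigger (CallE f m v)) (\<lambda>a. Ret (projl a))"

definition eval_bool ::
  "('expr, 'lval, 'mem, 'var, 'val, 'err) lang \<Rightarrow> 'expr \<Rightarrow> ('mem, 'var, 'val) state
     \<Rightarrow> ('err, bool) err_tree" where
  "eval_bool L e \<sigma> = bind (eval L e \<sigma>) (\<lambda>v. val_of_option (type_err L) (val_bool L v))"

definition eval_size ::
  "('expr, 'lval, 'mem, 'var, 'val, 'err) lang \<Rightarrow> 'expr \<Rightarrow> ('mem, 'var, 'val) state
     \<Rightarrow> ('err, nat) err_tree" where
  "eval_size L e \<sigma> = bind (eval L e \<sigma>) (\<lambda>v. val_of_option (type_err L) (val_size L v))"

primrec call_sem ::
  "('expr, 'lval, 'mem, 'var, 'val, 'err) lang \<Rightarrow> ('expr, 'lval, 'f) cmd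
     \<Rightarrow> ('mem, 'var, 'val) state
     \<Rightarrow> ('f, 'mem, 'val, 'err, ('mem, 'var, 'val) state) cmd_tree" where
  "call_sem L Skip = (\<lambda>\<sigma>. Ret \<sigma>)"
| "call_sem L (Assign l e) = (\<lambda>\<sigma>.
     bind (lift_err (eval L e \<sigma>)) (\<lambda>v. lift_err (put L l v \<sigma>)))"
| "call_sem L (Rand l e) = (\<lambda>\<sigma>.
     bind (lift_err (eval_size L e \<sigma>)) (\<lambda>n.
     bind (trigger_rnd n) (\<lambda>a.
     lift_err (put L l (bytes_val L a) \<sigma>))))"
| "call_sem L (Call l f e) = (\<lambda>\<sigma>.
     bind (lift_err (eval L e \<sigma>)) (\<lambda>v.
     bind (trigger_call f (fst \<sigma>) v) (\<lambda>(m', v').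
     lift_err (put L l v' (m', snd \<sigma>)))))"
| "call_sem L (Seq c c') = (\<lambda>\<sigma>. bind (call_sem L c \<sigma>) (call_sem L c'))"
| "call_sem L (If e c c') = (\<lambda>\<sigma>.
     bind (lift_err (eval_bool L e \<sigma>)) (\<lambda>b. if b then call_sem L c \<sigma> else call_sem L c' \<sigma>))"
| "call_sem L (While e c) =
     iter (\<lambda>\<sigma>.
       bind (lift_err (eval_bool L e \<sigma>)) (\<lambda>b.
       if b then bind (call_sem L c \<sigma>) (\<lambda>\<sigma>'. Ret (Inl \<sigma>')) else Ret (Inr \<sigma>)))"

definition init_state ::
  "('expr, 'lval, 'mem, 'var, 'val, 'err) lang \<Rightarrow> ('expr, 'lval, 'f, 'var) func
     \<Rightarrow> 'mem \<Rightarrow> 'val \<Rightarrow> ('mem, 'var, 'val) state" where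
  "init_state L F m v = (m, (\<lambda>_. init_val L)(f_arg F := v))"

fun call_handler ::
  "('expr, 'lval, 'mem, 'var, 'val, 'err) lang \<Rightarrow> ('expr, 'lval, 'f, 'var) program
     \<Rightarrow> 'f \<times> 'mem \<times> 'val \<Rightarrow> ('f, 'mem, 'val, 'err, 'mem \<times> 'val) cmd_tree" where
  "call_handler L P (f, m, v) = (case P f of
      Some F \<Rightarrow> bind (call_sem L (f_body F) (init_state L F m v))
                 (\<lambda>\<sigma>. Ret (fst \<sigma>, snd \<sigma> (f_res F)))
    | None \<Rightarrow> lift_err (throw (call_err L)))"

definition sem ::
  "('expr, 'lval, 'mem, 'var, 'val, 'err) lang \<Rightarrow> ('expr, 'lval, 'f, 'var) program
     \<Rightarrow> ('expr, 'lval, 'f) cmd \<Rightarrow> ('mem, 'var, 'val) state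
     \<Rightarrow> ('err, ('mem, 'var, 'val) state) ext_tree" where
  "sem L P c \<sigma> = interp_mrec (call_handler L P) (call_sem L c \<sigma>)"


section \<open>Validity\<close>

type_synonym ('mem, 'var, 'val) srel =
  "('mem, 'var, 'val) state \<Rightarrow> ('mem, 'var, 'val) state \<Rightarrow> bool"

type_synonym 'err ext_pre = "('err ext_event, 'err ext_event) epre"
type_synonym 'err ext_post =
  "('err ext_event, ext_answer, 'err ext_event, ext_answer) epost"
type_synonym ('f, 'mem, 'val, 'err) cmd_pre =
  "(('f, 'mem, 'val, 'err) cmd_event, ('f, 'mem, 'val, 'err) cmd_event) epre"
type_synonym ('f, 'mem, 'val, 'err) cmd_post =
  "(('f, 'mem, 'val, 'err) cmd_event, ('mem, 'val) cmd_answer,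
    ('f, 'mem, 'val, 'err) cmd_event, ('mem, 'val) cmd_answer) epost"

definition prog_valid ::
  "('expr, 'lval, 'mem, 'var, 'val, 'err) lang
     \<Rightarrow> 'err ext_pre \<Rightarrow> 'err ext_post
     \<Rightarrow> ('expr, 'lval, 'f, 'var) program \<Rightarrow> ('expr, 'lval, 'f, 'var) program
     \<Rightarrow> ('f \<Rightarrow> 'f \<Rightarrow> ('mem, 'var, 'val) srel) \<Rightarrow> ('f \<Rightarrow> 'f \<Rightarrow> ('mem, 'var, 'val) srel) \<Rightarrow> bool" where
  "prog_valid L IP IQ P1 P2 \<Phi> \<Psi> \<longleftrightarrow>
     (\<forall>f g F G \<sigma>1 \<sigma>2. P1 f = Some F \<longrightarrow> P2 g = Some G \<longrightarrow> \<Phi> f g \<sigma>1 \<sigma>2 \<longrightarrow>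
        eqcut ext_answers ext_answers isl (\<lambda>_. False) IP IQ (\<Psi> f g)
          (sem L P1 (f_body F) \<sigma>1) (sem L P2 (f_body G) \<sigma>2))"

text \<open>
  Trees of expressions and left-values only have \<open>Err\<close> events, all of which are cutoffs on the
  left. Hence it does not matter which contract is used to compare them.
\<close>

definition eqcut_err :: "('r1 \<Rightarrow> 'r2 \<Rightarrow> bool) \<Rightarrow> ('err, 'r1) err_tree \<Rightarrow> ('err, 'r2) err_tree \<Rightarrow> bool" where
  "eqcut_err = eqcut err_answers err_answers (\<lambda>_. True) (\<lambda>_. False) (\<lambda>_ _. False) (\<lambda>_ _. False)"

lemma eqcut_err_contract:
  "eqcut err_answers err_answers (\<lambda>_. True) (\<lambda>_. False) IP IQ \<phi> t1 t2 \<longleftrightarrow> eqcut_err \<phi> t1 t2"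
proof -
  let ?E = "eqcut err_answers err_answers (\<lambda>_. True) (\<lambda>_. False)"
  have *: "?E IP' IQ' \<phi> t1 t2" if "?E IP IQ \<phi> t1 t2" for IP IQ IP' IQ'
    using that
  proof (rule eqcut.coinduct[of "?E IP IQ \<phi>"])
    fix t1 t2
    assume "?E IP IQ \<phi> t1 t2"
    then have "eqcut_step err_answers err_answers (\<lambda>_. True) (\<lambda>_. False) IP IQ \<phi> (?E IP IQ \<phi>) t1 t2"
      by (rule eqcut.cases) blast
    then have "eqcut_step err_answers err_answers (\<lambda>_. True) (\<lambda>_. False) IP' IQ' \<phi>
        (\<lambda>t1 t2. ?E IP IQ \<phi> t1 t2 \<or> ?E IP' IQ' \<phi> t1 t2) t1 t2"
      by induction (blast intro: eqcut_step.Ret eqcut_step.Tau eqcut_step.TauL eqcut_step.TauR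
          eqcut_step.CutL)+
    then show "\<exists>u1 u2. t1 = u1 \<and> t2 = u2 \<and>
        eqcut_step err_answers err_answers (\<lambda>_. True) (\<lambda>_. False) IP' IQ' \<phi>
          (\<lambda>t1 t2. ?E IP IQ \<phi> t1 t2 \<or> ?E IP' IQ' \<phi> t1 t2) u1 u2"
      by simp
  qed
  show ?thesis
    unfolding eqcut_err_def by (rule iffI; erule *)
qed

definition expr_valid ::
  "('expr, 'lval, 'mem, 'var, 'val, 'err) lang \<Rightarrow> 'expr \<Rightarrow> 'expr
     \<Rightarrow> ('mem, 'var, 'val) srel \<Rightarrow> ('val \<Rightarrow> 'val \<Rightarrow> bool) \<Rightarrow> bool" where
  "expr_valid L e1 e2 \<Phi> \<psi> \<longleftrightarrow>
     (\<forall>\<sigma>1 \<sigma>2. \<Phi> \<sigma>1 \<sigma>2 \<longrightarrow> eqcut_err \<psi> (eval L e1 \<sigma>1) (eval L e2 \<sigma>2))"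

definition lval_valid ::
  "('expr, 'lval, 'mem, 'var, 'val, 'err) lang \<Rightarrow> 'lval \<Rightarrow> 'lval
     \<Rightarrow> ('mem, 'var, 'val) srel \<Rightarrow> ('val \<Rightarrow> 'val \<Rightarrow> bool) \<Rightarrow> ('mem, 'var, 'val) srel \<Rightarrow> bool" where
  "lval_valid L l1 l2 \<Phi> \<phi> \<Psi> \<longleftrightarrow>
     (\<forall>\<sigma>1 \<sigma>2 v1 v2. \<Phi> \<sigma>1 \<sigma>2 \<longrightarrow> \<phi> v1 v2 \<longrightarrow>
        eqcut_err \<Psi> (put L l1 v1 \<sigma>1) (put L l2 v2 \<sigma>2))"


section \<open>Proof rules\<close>

text \<open>\<open>e\<close> is \<open>b\<close> in the left state.\<close>

definition guard ::
  "('expr, 'lval, 'mem, 'var, 'val, 'err) lang \<Rightarrow> 'expr \<Rightarrow> bool \<Rightarrow> ('mem, 'var, 'val) srel" where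
  "guard L e b = (\<lambda>\<sigma>1 \<sigma>2. weak_bisim err_answers (eval_bool L e \<sigma>1) (Ret b))"

text \<open>The relations on values by which the contract for \<open>Rnd\<close> enters the rule for sampling.\<close>

definition rnd_pre ::
  "('expr, 'lval, 'mem, 'var, 'val, 'err) lang \<Rightarrow> ('f, 'mem, 'val, 'err) cmd_pre
     \<Rightarrow> 'val \<Rightarrow> 'val \<Rightarrow> bool" where
  "rnd_pre L IP v1 v2 \<longleftrightarrow>
     (\<exists>n1 n2. val_size L v1 = Some n1 \<and> val_size L v2 = Some n2 \<and> IP (RndE n1) (RndE n2))"

definition rnd_post ::
  "('expr, 'lval, 'mem, 'var, 'val, 'err) lang \<Rightarrow> ('f, 'mem, 'val, 'err) cmd_pre
     \<Rightarrow> ('f, 'mem, 'val, 'err) cmd_post \<Rightarrow> 'val \<Rightarrow> 'val \<Rightarrow> bool" where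
  "rnd_post L IP IQ v1 v2 \<longleftrightarrow>
     (\<exists>n1 n2. IP (RndE n1) (RndE n2) \<and>
       (\<exists>a1\<in>rnd_answers n1. \<exists>a2\<in>rnd_answers n2.
          IQ (RndE n1, RndA a1) (RndE n2, RndA a2) \<and> v1 = bytes_val L a1 \<and> v2 = bytes_val L a2))"

definition split_contract ::
  "('f, 'mem, 'val, 'err) cmd_pre \<Rightarrow> ('f, 'mem, 'val, 'err) cmd_post \<Rightarrow> 'f \<Rightarrow> 'f
     \<Rightarrow> ('mem \<Rightarrow> 'mem \<Rightarrow> bool) \<Rightarrow> ('val \<Rightarrow> 'val \<Rightarrow> bool)
     \<Rightarrow> ('mem \<Rightarrow> 'mem \<Rightarrow> bool) \<Rightarrow> ('val \<Rightarrow> 'val \<Rightarrow> bool) \<Rightarrow> bool" where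
  "split_contract IP IQ f g IPm IPv IQm IQv \<longleftrightarrow>
     (\<forall>m1 v1 m2 v2. IP (CallE f m1 v1) (CallE g m2 v2) \<longleftrightarrow> IPm m1 m2 \<and> IPv v1 v2) \<and>
     (\<forall>m1 v1 m2 v2 m1' v1' m2' v2'.
        IQ (CallE f m1 v1, CallA m1' v1') (CallE g m2 v2, CallA m2' v2')
          \<longleftrightarrow> IQm m1' m2' \<and> IQv v1' v2')"

definition srel_of ::
  "(('var \<Rightarrow> 'val) \<Rightarrow> ('var \<Rightarrow> 'val) \<Rightarrow> bool) \<Rightarrow> ('mem \<Rightarrow> 'mem \<Rightarrow> bool) \<Rightarrow> ('mem, 'var, 'val) srel" where
  "srel_of \<Phi>r R = (\<lambda>\<sigma>1 \<sigma>2. \<Phi>r (snd \<sigma>1) (snd \<sigma>2) \<and> R (fst \<sigma>1) (fst \<sigma>2))"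

definition post_le :: "('e \<Rightarrow> 'a set) \<Rightarrow> ('e, 'a, 'e, 'a) epost \<Rightarrow> ('e, 'a, 'e, 'a) epost \<Rightarrow> bool" where
  "post_le A IQ IQ' \<longleftrightarrow>
     (\<forall>e1 e2. \<forall>a1\<in>A e1. \<forall>a2\<in>A e2. IQ (e1, a1) (e2, a2) \<longrightarrow> IQ' (e1, a1) (e2, a2))"

text \<open>
  A postcondition is a family of relations on answers, indexed by the two events. Postconditions are
  composed as relations on answers along the event that links the outer two: answers to \<open>e1\<close> and \<open>e3\<close> are
  related iff they are related by \<open>IQ1\<close> followed by \<open>IQ2\<close>, at every event \<open>e2\<close> by which the composed
  precondition can relate \<open>e1\<close> to \<open>e3\<close>. Composing instead through an arbitrary pair of an event and
  an answer would let \<open>a1\<close> and \<open>a3\<close> be linked by answers to an event that the middle command never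
  performs; transitivity of the logic would then fail.
\<close>

definition post_comp ::
  "('e \<Rightarrow> 'a set) \<Rightarrow> ('e, 'e) epre \<Rightarrow> ('e, 'e) epre
     \<Rightarrow> ('e, 'a, 'e, 'a) epost \<Rightarrow> ('e, 'a, 'e, 'a) epost \<Rightarrow> ('e, 'a, 'e, 'a) epost" where
  "post_comp A IP1 IP2 IQ1 IQ2 = (\<lambda>(e1, a1) (e3, a3).
     \<forall>e2. IP1 e1 e2 \<longrightarrow> IP2 e2 e3 \<longrightarrow> (\<exists>a2\<in>A e2. IQ1 (e1, a1) (e2, a2) \<and> IQ2 (e2, a2) (e3, a3)))"

inductive hoare ::
  "('expr, 'lval, 'mem, 'var, 'val, 'err) lang
     \<Rightarrow> ('f, 'mem, 'val, 'err) cmd_pre \<Rightarrow> ('f, 'mem, 'val, 'err) cmd_post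
     \<Rightarrow> ('expr, 'lval, 'f) cmd \<Rightarrow> ('expr, 'lval, 'f) cmd
     \<Rightarrow> ('mem, 'var, 'val) srel \<Rightarrow> ('mem, 'var, 'val) srel \<Rightarrow> bool"
  for L where
  Skip: "hoare L IP IQ Skip Skip \<Phi> \<Phi>"
| Seq: "hoare L IP IQ c1 c2 \<Phi> \<Phi>' \<Longrightarrow> hoare L IP IQ c1' c2' \<Phi>' \<Phi>''
    \<Longrightarrow> hoare L IP IQ (Seq c1 c1') (Seq c2 c2') \<Phi> \<Phi>''"
| Assign: "expr_valid L e1 e2 \<Phi> \<phi> \<Longrightarrow> lval_valid L l1 l2 \<Phi> \<phi> \<Psi>
    \<Longrightarrow> hoare L IP IQ (Assign l1 e1) (Assign l2 e2) \<Phi> \<Psi>"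
| Case: "expr_valid L e1 e2 \<Phi> (=)
    \<Longrightarrow> hoare L IP IQ c1 c2 (\<lambda>\<sigma>1 \<sigma>2. \<Phi> \<sigma>1 \<sigma>2 \<and> guard L e1 True \<sigma>1 \<sigma>2) \<Psi>
    \<Longrightarrow> hoare L IP IQ c1' c2' (\<lambda>\<sigma>1 \<sigma>2. \<Phi> \<sigma>1 \<sigma>2 \<and> guard L e1 False \<sigma>1 \<sigma>2) \<Psi>
    \<Longrightarrow> hoare L IP IQ (If e1 c1 c1') (If e2 c2 c2') \<Phi> \<Psi>"
| While: "expr_valid L e1 e2 \<Phi> (=)
    \<Longrightarrow> hoare L IP IQ c1 c2 (\<lambda>\<sigma>1 \<sigma>2. \<Phi> \<sigma>1 \<sigma>2 \<and> guard L e1 True \<sigma>1 \<sigma>2) \<Phi>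
    \<Longrightarrow> hoare L IP IQ (While e1 c1) (While e2 c2)
          \<Phi> (\<lambda>\<sigma>1 \<sigma>2. \<Phi> \<sigma>1 \<sigma>2 \<and> guard L e1 False \<sigma>1 \<sigma>2)"
| Rand: "expr_valid L e1 e2 \<Phi> (rnd_pre L IP) \<Longrightarrow> lval_valid L l1 l2 \<Phi> (rnd_post L IP IQ) \<Psi>
    \<Longrightarrow> hoare L IP IQ (Rand l1 e1) (Rand l2 e2) \<Phi> \<Psi>"
| Call: "split_contract IP IQ f g IPm IPv IQm IQv
    \<Longrightarrow> expr_valid L e1 e2 (srel_of \<Phi>r IPm) IPv
    \<Longrightarrow> lval_valid L l1 l2 (srel_of \<Phi>r IQm) IQv \<Psi>
    \<Longrightarrow> hoare L IP IQ (Call l1 f e1) (Call l2 g e2) (srel_of \<Phi>r IPm) \<Psi>"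
| AssignL: "(\<And>\<sigma>1 \<sigma>1' \<sigma>2. \<Phi> \<sigma>1 \<sigma>2
        \<Longrightarrow> weak_bisim cmd_answers
              (call_sem L (Assign l e) \<sigma>1 :: ('f, 'mem, 'val, 'err, ('mem, 'var, 'val) state) cmd_tree)
              (Ret \<sigma>1')
        \<Longrightarrow> \<Psi> \<sigma>1' \<sigma>2)
    \<Longrightarrow> hoare L IP IQ (Assign l e) Skip \<Phi> \<Psi>"
| Conseq: "hoare L IP' IQ' c1 c2 \<Phi>' \<Psi>'
    \<Longrightarrow> \<Phi> \<le> \<Phi>' \<Longrightarrow> \<Psi>' \<le> \<Psi> \<Longrightarrow> IP' \<le> IP \<Longrightarrow> post_le cmd_answers IQ IQ'
    \<Longrightarrow> hoare L IP IQ c1 c2 \<Phi> \<Psi>"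
| Trans: "hoare L IP1 IQ1 c1 c2 \<Phi>1 \<Psi>1 \<Longrightarrow> hoare L IP2 IQ2 c2 c3 \<Phi>2 \<Psi>2
    \<Longrightarrow> hoare L (IP1 OO IP2) (post_comp cmd_answers IP1 IP2 IQ1 IQ2) c1 c3 (\<Phi>1 OO \<Phi>2) (\<Psi>1 OO \<Psi>2)"

fun pre_union ::
  "('expr, 'lval, 'mem, 'var, 'val, 'err) lang
     \<Rightarrow> ('expr, 'lval, 'f, 'var) program \<Rightarrow> ('expr, 'lval, 'f, 'var) program
     \<Rightarrow> 'err ext_pre \<Rightarrow> ('f \<Rightarrow> 'f \<Rightarrow> ('mem, 'var, 'val) srel) \<Rightarrow> ('f, 'mem, 'val, 'err) cmd_pre" where
  "pre_union L P1 P2 IP \<Phi> (Inl (f, m1, v1)) (Inl (g, m2, v2)) \<longleftrightarrow>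
     (\<exists>F G. P1 f = Some F \<and> P2 g = Some G \<and>
        \<Phi> f g (init_state L F m1 v1) (init_state L G m2 v2))"
| "pre_union L P1 P2 IP \<Phi> (Inr e1) (Inr e2) \<longleftrightarrow> IP e1 e2"
| "pre_union L P1 P2 IP \<Phi> _ _ \<longleftrightarrow> False"

fun post_union ::
  "('expr, 'lval, 'f, 'var) program \<Rightarrow> ('expr, 'lval, 'f, 'var) program
     \<Rightarrow> 'err ext_post \<Rightarrow> ('f \<Rightarrow> 'f \<Rightarrow> ('mem, 'var, 'val) srel) \<Rightarrow> ('f, 'mem, 'val, 'err) cmd_post" where
  "post_union P1 P2 IQ \<Psi> (Inl (f, m1, v1), Inl (m1', v1')) (Inl (g, m2, v2), Inl (m2', v2')) \<longleftrightarrow>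
     (\<exists>F G \<sigma>1' \<sigma>2'. P1 f = Some F \<and> P2 g = Some G \<and> \<Psi> f g \<sigma>1' \<sigma>2' \<and>
        m1' = fst \<sigma>1' \<and> v1' = snd \<sigma>1' (f_res F) \<and> m2' = fst \<sigma>2' \<and> v2' = snd \<sigma>2' (f_res G))"
| "post_union P1 P2 IQ \<Psi> (Inr e1, Inr a1) (Inr e2, Inr a2) \<longleftrightarrow> IQ (e1, a1) (e2, a2)"
| "post_union P1 P2 IQ \<Psi> _ _ \<longleftrightarrow> False"

inductive prog_hoare ::
  "('expr, 'lval, 'mem, 'var, 'val, 'err) lang
     \<Rightarrow> 'err ext_pre \<Rightarrow> 'err ext_post
     \<Rightarrow> ('expr, 'lval, 'f, 'var) program \<Rightarrow> ('expr, 'lval, 'f, 'var) program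
     \<Rightarrow> ('f \<Rightarrow> 'f \<Rightarrow> ('mem, 'var, 'val) srel) \<Rightarrow> ('f \<Rightarrow> 'f \<Rightarrow> ('mem, 'var, 'val) srel) \<Rightarrow> bool"
  for L where
  Rec: "(\<And>f g F G. P1 f = Some F \<Longrightarrow> P2 g = Some G \<Longrightarrow>
        hoare L (pre_union L P1 P2 IP \<Phi>) (post_union P1 P2 IQ \<Psi>)
          (f_body F) (f_body G) (\<Phi> f g) (\<Psi> f g))
    \<Longrightarrow> prog_hoare L IP IQ P1 P2 \<Phi> \<Psi>"

end

theory Submission
  imports Defs
begin

text \<open>
  Soundness of the command judgments is proved by induction over the derivation. The induction needs
  a property stronger than equivalence up-to-cutoff under the contract: a program event may only be
  matched with an event on the right that is \<^emph>\<open>not\<close> an error. This is what makes rule Trans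
  sound: an error of the middle program cuts off the second equivalence, and since it cannot be
  matched in the first one, the left program must have failed, too. The recursion rule then holds
  because \<open>interp_mrec\<close> maps equivalent trees to equivalent trees as soon as the handlers are
  equivalent at related calls; each unfolding of a call produces a \<open>Tau\<close> on both sides, which
  guards the coinduction.
\<close>

section \<open>Equivalence up-to-cutoff\<close>

lemma eqcut_unfold:
  "eqcut A1 A2 cutL cutR IP IQ \<phi> t1 t2 \<longleftrightarrow>
    eqcut_step A1 A2 cutL cutR IP IQ \<phi> (eqcut A1 A2 cutL cutR IP IQ \<phi>) t1 t2"
  by (auto elim: eqcut.cases intro: eqcut.intros)

lemma eqcut_step_weaken:
  assumes "eqcut_step A1 A2 cutL cutR IP IQ \<phi> X t1 t2"
    and "\<And>t1 t2. X t1 t2 \<Longrightarrow> Y t1 t2"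
  shows "eqcut_step A1 A2 cutL cutR IP IQ \<phi> Y t1 t2"
  using assms eqcut_step_mono by metis

text \<open>Successors may also be equivalent outright; \<open>eqcut_bind\<close> needs this once
  both trees have returned and the continuations take over.\<close>

lemma eqcut_coinduct [consumes 1, case_names step]:
  assumes "X t1 t2"
    and "\<And>u1 u2. X u1 u2 \<Longrightarrow>
      eqcut_step A1 A2 cutL cutR IP IQ \<phi>
        (\<lambda>u1 u2. X u1 u2 \<or> eqcut A1 A2 cutL cutR IP IQ \<phi> u1 u2) u1 u2"
  shows "eqcut A1 A2 cutL cutR IP IQ \<phi> t1 t2"
  using assms(1) by (rule eqcut.coinduct[of X]) (use assms(2) in blast)

lemma eqcut_Ret: "\<phi> r1 r2 \<Longrightarrow> eqcut A1 A2 cutL cutR IP IQ \<phi> (Ret r1) (Ret r2)"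
  by (intro eqcut.intros eqcut_step.Ret)

lemma eqcut_CutL: "cutL e \<Longrightarrow> eqcut A1 A2 cutL cutR IP IQ \<phi> (Vis e k) t2"
  by (intro eqcut.intros eqcut_step.CutL)

lemma eqcut_TauL:
  "eqcut A1 A2 cutL cutR IP IQ \<phi> t1 t2 \<Longrightarrow> eqcut A1 A2 cutL cutR IP IQ \<phi> (Tau t1) t2"
  by (metis eqcut_unfold eqcut_step.TauL)

lemma eqcut_Vis:
  assumes "IP e1 e2"
    and "\<And>a1 a2. a1 \<in> A1 e1 \<Longrightarrow> a2 \<in> A2 e2 \<Longrightarrow> IQ (e1, a1) (e2, a2)
      \<Longrightarrow> eqcut A1 A2 cutL cutR IP IQ \<phi> (k1 a1) (k2 a2)"
  shows "eqcut A1 A2 cutL cutR IP IQ \<phi> (Vis e1 k1) (Vis e2 k2)"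
  by (rule eqcut.intros, rule eqcut_step.Vis) (use assms in auto)

section \<open>Monotonicity, sequencing and iteration\<close>

text \<open>A smaller \<open>IQ'\<close> leaves fewer answers for which continuations must agree,
  hence the reversed direction.\<close>

lemma eqcut_mono:
  assumes "eqcut A1 A2 cutL cutR IP IQ \<phi> t1 t2"
    and IP: "\<And>e1 e2. IP e1 e2 \<Longrightarrow> IP' e1 e2"
    and IQ: "\<And>e1 e2 a1 a2. a1 \<in> A1 e1 \<Longrightarrow> a2 \<in> A2 e2 \<Longrightarrow> IQ' (e1, a1) (e2, a2) \<Longrightarrow> IQ (e1, a1) (e2, a2)"
    and \<phi>: "\<And>r1 r2. \<phi> r1 r2 \<Longrightarrow> \<phi>' r1 r2"
  shows "eqcut A1 A2 cutL cutR IP' IQ' \<phi>' t1 t2"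
  using assms(1)
proof (coinduction arbitrary: t1 t2 rule: eqcut_coinduct)
  case step
  then have "eqcut_step A1 A2 cutL cutR IP IQ \<phi> (eqcut A1 A2 cutL cutR IP IQ \<phi>) t1 t2"
    by (simp only: eqcut_unfold[symmetric])
  then show ?case
    by induction (auto intro: eqcut_step.intros IP IQ \<phi>)
qed

lemma eqcut_bind:
  assumes "eqcut A1 A2 cutL cutR IP IQ \<phi> t1 t2"
    and k: "\<And>r1 r2. \<phi> r1 r2 \<Longrightarrow> eqcut A1 A2 cutL cutR IP IQ \<psi> (k1 r1) (k2 r2)"
  shows "eqcut A1 A2 cutL cutR IP IQ \<psi> (bind t1 k1) (bind t2 k2)"
  using assms(1)
proof (coinduction arbitrary: t1 t2 rule: eqcut_coinduct)
  case step
  then have "eqcut_step A1 A2 cutL cutR IP IQ \<phi> (eqcut A1 A2 cutL cutR IP IQ \<phi>) t1 t2"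
    by (simp only: eqcut_unfold[symmetric])
  then show ?case
  proof induction
    case (Ret r1 r2)
    then have "eqcut_step A1 A2 cutL cutR IP IQ \<psi> (eqcut A1 A2 cutL cutR IP IQ \<psi>) (k1 r1) (k2 r2)"
      using k eqcut_unfold by metis
    then show ?case
      unfolding bind_simps by (rule eqcut_step_weaken) simp
  qed (auto intro!: eqcut_step.Tau eqcut_step.Vis
      intro: eqcut_step.TauL eqcut_step.TauR eqcut_step.CutL eqcut_step.CutR)
qed

text \<open>\<open>R\<close> acts as a loop invariant. An \<open>Inl\<close> result becomes a
  \<open>Tau\<close> on both sides, and this pair of \<open>Tau\<close>s guards the
  coinduction.\<close>

lemma eqcut_iter:
  assumes body: "\<And>i1 i2. R i1 i2 \<Longrightarrow>
      eqcut A1 A2 cutL cutR IP IQ (rel_sum R \<phi>) (body1 i1) (body2 i2)"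
    and "R i1 i2"
  shows "eqcut A1 A2 cutL cutR IP IQ \<phi> (iter body1 i1) (iter body2 i2)"
proof -
  \<comment> \<open>Generalized from the start of a round to any point within it, since a step of
    the loop exposes a remainder of the body's tree.\<close>
  have "eqcut A1 A2 cutL cutR IP IQ \<phi> (run_iter body1 t1) (run_iter body2 t2)"
    if "eqcut A1 A2 cutL cutR IP IQ (rel_sum R \<phi>) t1 t2" for t1 t2
    using that
  proof (coinduction arbitrary: t1 t2 rule: eqcut_coinduct)
    case step
    then have "eqcut_step A1 A2 cutL cutR IP IQ (rel_sum R \<phi>)
        (eqcut A1 A2 cutL cutR IP IQ (rel_sum R \<phi>)) t1 t2"
      by (simp only: eqcut_unfold[symmetric])
    then show ?case
    proof induction
      case (Ret r1 r2)
      then show ?case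
      proof cases
        case (1 i1 i2)
        with body show ?thesis
          by (auto simp: run_iter_simps iter_def intro!: eqcut_step.Tau)
      qed (auto simp: run_iter_simps intro: eqcut_step.Ret)
    qed (auto simp: run_iter_simps intro!: eqcut_step.Tau eqcut_step.Vis
        intro: eqcut_step.TauL eqcut_step.TauR eqcut_step.CutL eqcut_step.CutR)
  qed
  with assms show ?thesis
    by (simp add: iter_def)
qed

section \<open>Transitivity\<close>

text \<open>If the coinductive rule stripped a \<open>Tau\<close> from both sides,
  \<open>TauR\<close> puts the right one back after unfolding the successor.\<close>

lemma eqcut_Tau_leftD:
  assumes "eqcut A1 A2 cutL cutR IP IQ \<phi> (Tau t1) t2"
  shows "eqcut A1 A2 cutL cutR IP IQ \<phi> t1 t2"
proof -
  have "eqcut_step A1 A2 cutL cutR IP IQ \<phi> (eqcut A1 A2 cutL cutR IP IQ \<phi>) (Tau t1) t2"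
    using assms by (simp only: eqcut_unfold[symmetric])
  then have "eqcut_step A1 A2 cutL cutR IP IQ \<phi> (eqcut A1 A2 cutL cutR IP IQ \<phi>) t1 t2"
    by (induction "Tau t1" t2) (auto intro: eqcut_step.intros eqcut_step.TauR[OF iffD1[OF eqcut_unfold]])
  then show ?thesis
    by (rule eqcut.intros)
qed

lemma eqcut_Tau_rightD:
  assumes "eqcut A1 A2 cutL cutR IP IQ \<phi> t1 (Tau t2)"
  shows "eqcut A1 A2 cutL cutR IP IQ \<phi> t1 t2"
proof -
  have "eqcut_step A1 A2 cutL cutR IP IQ \<phi> (eqcut A1 A2 cutL cutR IP IQ \<phi>) t1 (Tau t2)"
    using assms by (simp only: eqcut_unfold[symmetric])
  then have "eqcut_step A1 A2 cutL cutR IP IQ \<phi> (eqcut A1 A2 cutL cutR IP IQ \<phi>) t1 t2"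
    by (induction t1 "Tau t2") (auto intro: eqcut_step.intros eqcut_step.TauL[OF iffD1[OF eqcut_unfold]])
  then show ?thesis
    by (rule eqcut.intros)
qed

text \<open>By \<open>cut\<close>, a middle event matched by the first equivalence is no cutoff of
  the second one, so the second must match it as well. \<open>IQ\<close> may be any postcondition
  whose answers can be linked at every possible middle event.\<close>

lemma eqcut_trans:
  fixes t1 :: "('e1, 'a1, 'r1) itree" and t2 :: "('e2, 'a2, 'r2) itree"
    and t3 :: "('e3, 'a3, 'r3) itree"
  assumes E12: "eqcut A1 A2 cutL (\<lambda>_. False) IP1 IQ1 \<phi>1 t1 t2"
    and E23: "eqcut A2 A3 cutL' (\<lambda>_. False) IP2 IQ2 \<phi>2 t2 t3"
    and cut: "\<And>e1 e2. IP1 e1 e2 \<Longrightarrow> \<not> cutL' e2"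
    and IQ: "\<And>e1 e2 e3 a1 a3. IP1 e1 e2 \<Longrightarrow> IP2 e2 e3 \<Longrightarrow> a1 \<in> A1 e1 \<Longrightarrow> a3 \<in> A3 e3
      \<Longrightarrow> IQ (e1, a1) (e3, a3) \<Longrightarrow> \<exists>a2\<in>A2 e2. IQ1 (e1, a1) (e2, a2) \<and> IQ2 (e2, a2) (e3, a3)"
  shows "eqcut A1 A3 cutL (\<lambda>_. False) (IP1 OO IP2) IQ (\<phi>1 OO \<phi>2) t1 t3"
proof -
  define E1 where "E1 = eqcut A1 A2 cutL (\<lambda>_. False) IP1 IQ1 \<phi>1"
  define E2 where "E2 = eqcut A2 A3 cutL' (\<lambda>_. False) IP2 IQ2 \<phi>2"
  define S1 where "S1 = eqcut_step A1 A2 cutL (\<lambda>_. False) IP1 IQ1 \<phi>1 E1"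
  define S2 where "S2 = eqcut_step A2 A3 cutL' (\<lambda>_. False) IP2 IQ2 \<phi>2 E2"
  define S where "S = eqcut_step A1 A3 cutL (\<lambda>_. False) (IP1 OO IP2) IQ (\<phi>1 OO \<phi>2)
    (\<lambda>t1 t3. (E1 OO E2) t1 t3 \<or> eqcut A1 A3 cutL (\<lambda>_. False) (IP1 OO IP2) IQ (\<phi>1 OO \<phi>2) t1 t3)"
  have S1: "E1 t1 t2 \<longleftrightarrow> S1 t1 t2" for t1 t2
    unfolding S1_def E1_def by (rule eqcut_unfold)
  have S2: "E2 t1 t2 \<longleftrightarrow> S2 t1 t2" for t1 t2
    unfolding S2_def E2_def by (rule eqcut_unfold)
  have at_Ret: "S t1 t3" if "S1 t1 (Ret r2)" "S2 (Ret r2) t3" for t1 t3 r2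
    using that(1) unfolding S1_def
  proof (induction t1 "Ret r2 :: ('e2, 'a2, 'r2) itree")
    case (Ret r1)
    from that(2) Ret show ?case
      unfolding S2_def S_def
      by (induction "Ret r2 :: ('e2, 'a2, 'r2) itree" t3) (auto intro: eqcut_step.intros)
  qed (auto simp: S_def intro: eqcut_step.intros)
  have at_Vis: "S t1 t3" if "S1 t1 (Vis e2 k2)" "S2 (Vis e2 k2) t3" for t1 t3 e2 k2
    using that(1) unfolding S1_def
  proof (induction t1 "Vis e2 k2")
    case (Vis e1 k1)
    note Vis1 = Vis
    from that(2) show ?case
      unfolding S2_def S_def
    proof (induction "Vis e2 k2" t3)
      case (Vis e3 k3)
      show ?case
      proof (rule eqcut_step.Vis)
        show "(IP1 OO IP2) e1 e3"
          using \<open>IP1 e1 e2\<close> \<open>IP2 e2 e3\<close> by blast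
        fix a1 a3
        assume "a1 \<in> A1 e1" "a3 \<in> A3 e3" "IQ (e1, a1) (e3, a3)"
        then obtain a2 where "a2 \<in> A2 e2" "IQ1 (e1, a1) (e2, a2)" "IQ2 (e2, a2) (e3, a3)"
          using IQ \<open>IP1 e1 e2\<close> \<open>IP2 e2 e3\<close> by blast
        with \<open>a1 \<in> A1 e1\<close> \<open>a3 \<in> A3 e3\<close> Vis1(2) Vis(2)
        show "(E1 OO E2) (k1 a1) (k3 a3) \<or> eqcut A1 A3 cutL (\<lambda>_. False) (IP1 OO IP2) IQ (\<phi>1 OO \<phi>2) (k1 a1) (k3 a3)"
          by blast
      qed
    \<comment> \<open>Among the remaining cases, a cutoff at \<open>e2\<close> contradicts
      \<open>cut\<close>, because \<open>IP1 e1 e2\<close> holds.\<close>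
    qed (use Vis cut in \<open>auto intro: eqcut_step.intros\<close>)
  qed (auto simp: S_def intro: eqcut_step.intros)
  \<comment> \<open>When \<open>t1\<close> is no \<open>Tau\<close>, the first derivation strips
    finitely many \<open>Tau\<close>s from the middle tree and exposes a \<open>Ret\<close> or
    \<open>Vis\<close> there, unless \<open>t1\<close> is cut off.\<close>
  have left: "S t1 t3" if "S1 t1 t2" "S2 t2 t3" "\<And>u. t1 \<noteq> Tau u" for t1 t2 t3
    using that unfolding S1_def
  proof induction
    case (TauR t1 t2)
    then show ?case
      using S2 eqcut_Tau_leftD unfolding E2_def by blast
  next
    case (CutL e1 k1 t2)
    then show ?case
      unfolding S_def by (intro eqcut_step.CutL)
  next
    case (Ret r1 r2)
    then have "S1 (itree.Ret r1) (itree.Ret r2)"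
      unfolding S1_def by (intro eqcut_step.Ret)
    with Ret show ?case
      by (intro at_Ret)
  next
    case (Vis e1 e2 k1 k2)
    then have "S1 (itree.Vis e1 k1) (itree.Vis e2 k2)"
      unfolding S1_def by (intro eqcut_step.Vis)
    with Vis show ?case
      by (intro at_Vis)
  qed auto
  have right: "S t1 t3" if "S2 t2 t3" "S1 t1 t2" "\<And>u. t3 \<noteq> Tau u" for t1 t2 t3
    using that unfolding S2_def
  proof induction
    case (TauL t2 t3)
    then show ?case
      using S1 eqcut_Tau_rightD unfolding E1_def by blast
  next
    case (Ret r2 r3)
    then have "S2 (itree.Ret r2) (itree.Ret r3)"
      unfolding S2_def by (intro eqcut_step.Ret)
    with Ret show ?case
      by (intro at_Ret)
  next
    case (Vis e2 e3 k2 k3)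
    then have "S2 (itree.Vis e2 k2) (itree.Vis e3 k3)"
      unfolding S2_def by (intro eqcut_step.Vis)
    with Vis show ?case
      by (intro at_Vis)
  next
    case (CutL e2 k2 t3)
    then have "S2 (itree.Vis e2 k2) t3"
      unfolding S2_def by (intro eqcut_step.CutL)
    with CutL show ?case
      by (intro at_Vis)
  qed auto
  have step: "S t1 t3" if "E1 t1 t2" "E2 t2 t3" for t1 t2 t3
  proof (cases "(\<exists>u1. t1 = Tau u1) \<and> (\<exists>u3. t3 = Tau u3)")
    \<comment> \<open>Both outer \<open>Tau\<close>s are removed by the coinductive rule while the
      middle tree stays, so it may even diverge.\<close>
    case True
    then obtain u1 u3 where [simp]: "t1 = Tau u1" "t3 = Tau u3"
      by blast
    have "E1 u1 t2" "E2 t2 u3"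
      using that eqcut_Tau_leftD eqcut_Tau_rightD by (fastforce simp: E1_def E2_def)+
    then show ?thesis
      unfolding S_def by (auto intro: eqcut_step.Tau)
  next
    case False
    then show ?thesis
      using left right that S1 S2 by blast
  qed
  have "(E1 OO E2) t1 t3"
    using E12 E23 unfolding E1_def E2_def by blast
  then show ?thesis
    by (rule eqcut_coinduct) (use step in \<open>auto simp: S_def\<close>)
qed

section \<open>Recursive interpretation of calls\<close>

lemma interp_mrec_simps:
  "interp_mrec H (Ret r) = Ret r"
  "interp_mrec H (Tau t) = Tau (interp_mrec H t)"
  "interp_mrec H (Vis (Inl e) h) = Tau (interp_mrec H (bind (H e) (\<lambda>a. h (Inl a))))"
  "interp_mrec H (Vis (Inr e') h) = Vis e' (\<lambda>a. interp_mrec H (h (Inr a)))"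
  by (subst interp_mrec.code; simp)+

text \<open>A matched call becomes, after a \<open>Tau\<close> on each side, handler followed by
  continuation; these are related by \<open>eqcut_bind\<close>, and the \<open>Tau\<close>s guard
  the coinduction even if handlers call themselves. The result relation in \<open>H\<close> records
  the answer sets, because continuations are related only for answers in these sets.\<close>

lemma eqcut_interp_mrec:
  assumes eq: "eqcut (sum_answers A1 B1) (sum_answers A2 B2) cutL cutR IP IQ \<phi> t1 t2"
    and IP: "\<And>e1 e2. IP e1 e2 \<Longrightarrow> isl e1 \<longleftrightarrow> isl e2"
    and cutL: "\<And>e. \<not> cutL (Inl e)" and cutR: "\<And>e. \<not> cutR (Inl e)"
    and H: "\<And>e1 e2. IP (Inl e1) (Inl e2) \<Longrightarrow>
      eqcut (sum_answers A1 B1) (sum_answers A2 B2) cutL cutR IP IQ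
        (\<lambda>a1 a2. a1 \<in> A1 e1 \<and> a2 \<in> A2 e2 \<and> IQ (Inl e1, Inl a1) (Inl e2, Inl a2)) (H1 e1) (H2 e2)"
  shows "eqcut B1 B2 (\<lambda>e. cutL (Inr e)) (\<lambda>e. cutR (Inr e)) (\<lambda>e1 e2. IP (Inr e1) (Inr e2))
    (\<lambda>(e1, a1) (e2, a2). IQ (Inr e1, Inr a1) (Inr e2, Inr a2)) \<phi>
    (interp_mrec H1 t1) (interp_mrec H2 t2)"
  using eq
proof (coinduction arbitrary: t1 t2 rule: eqcut_coinduct)
  case step
  let ?E = "eqcut (sum_answers A1 B1) (sum_answers A2 B2) cutL cutR IP IQ"
  from step have "eqcut_step (sum_answers A1 B1) (sum_answers A2 B2) cutL cutR IP IQ \<phi> (?E \<phi>) t1 t2"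
    by (simp only: eqcut_unfold[symmetric])
  then show ?case
  proof induction
    case (Vis e1 e2 k1 k2)
    show ?case
    proof (cases e1)
      case (Inl f1)
      with Vis(1) IP obtain f2 where f2: "e2 = Inl f2"
        by (metis isl_def)
      have "?E \<phi> (bind (H1 f1) (\<lambda>a. k1 (Inl a))) (bind (H2 f2) (\<lambda>a. k2 (Inl a)))"
        using H Vis unfolding Inl f2 by (auto intro!: eqcut_bind)
      then show ?thesis
        unfolding Inl f2 interp_mrec_simps by (blast intro: eqcut_step.Tau)
    next
      case (Inr f1)
      with Vis(1) IP obtain f2 where f2: "e2 = Inr f2"
        by (metis isl_def obj_sumE sum.disc(2))
      show ?thesis
        using Vis unfolding Inr f2 interp_mrec_simps by (fastforce intro!: eqcut_step.Vis)
    qed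
  next
    case (CutL e1 k1 t2)
    then show ?case
      using cutL by (cases e1) (auto simp: interp_mrec_simps intro: eqcut_step.CutL)
  next
    case (CutR e2 t1 k2)
    then show ?case
      using cutR by (cases e2) (auto simp: interp_mrec_simps intro: eqcut_step.CutR)
  qed (auto simp: interp_mrec_simps intro: eqcut_step.Ret eqcut_step.Tau eqcut_step.TauL eqcut_step.TauR)
qed

section \<open>Results reached by the left tree\<close>

text \<open>With an empty precondition no events are matched, so a result of the left tree is
  compared only after it has been reached through \<open>Tau\<close>s alone. This yields the guards
  of branching and the premise of the one-sided assignment rule.\<close>

lemma eqcut_result:
  assumes "eqcut A1 A2 cutL (\<lambda>_. False) (\<lambda>_ _. False) IQ \<phi> t1 t2"
  shows "eqcut A1 A2 cutL (\<lambda>_. False) (\<lambda>_ _. False) IQ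
    (\<lambda>r1 r2. \<phi> r1 r2 \<and> weak_bisim A t1 (Ret r1)) t1 t2"
proof -
  let ?E = "eqcut A1 A2 cutL (\<lambda>_. False) (\<lambda>_ _. False) IQ"
  \<comment> \<open>\<open>X\<close> remembers that a result of the current remainder is also a
    result of the original \<open>t1\<close>.\<close>
  define X where "X u1 u2 \<longleftrightarrow> ?E \<phi> u1 u2 \<and>
    (\<forall>r. weak_bisim A u1 (Ret r) \<longrightarrow> weak_bisim A t1 (Ret r))" for u1 u2
  have "X t1 t2"
    using assms by (simp add: X_def)
  then show ?thesis
  proof (rule eqcut_coinduct)
    fix u1 u2
    assume "X u1 u2"
    then have "eqcut_step A1 A2 cutL (\<lambda>_. False) (\<lambda>_ _. False) IQ \<phi> (?E \<phi>) u1 u2"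
      and "\<forall>r. weak_bisim A u1 (Ret r) \<longrightarrow> weak_bisim A t1 (Ret r)"
      by (auto simp add: X_def eqcut_unfold[symmetric])
    then show "eqcut_step A1 A2 cutL (\<lambda>_. False) (\<lambda>_ _. False) IQ
        (\<lambda>r1 r2. \<phi> r1 r2 \<and> weak_bisim A t1 (Ret r1))
        (\<lambda>u1 u2. X u1 u2 \<or> ?E (\<lambda>r1 r2. \<phi> r1 r2 \<and> weak_bisim A t1 (Ret r1)) u1 u2) u1 u2"
    proof induction
      case (Ret r1 r2)
      then show ?case
        by (auto intro!: eqcut_step.Ret eqcut_Ret simp: weak_bisim_def)
    next
      case (Tau u1 u2)
      then show ?case
        by (auto intro!: eqcut_step.Tau simp: X_def weak_bisim_def intro: eqcut_TauL)
    next
      case (TauL u1 u2)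
      then show ?case
        by (auto intro!: eqcut_step.TauL simp: weak_bisim_def intro: eqcut_TauL)
    qed (auto intro: eqcut_step.TauR eqcut_step.CutL)
  qed
qed

text \<open>Finitely many \<open>Tau\<close>s lead to a result or to an event, and every left event
  is a cutoff here.\<close>

lemma halts_eqcut_Ret:
  assumes "halts t"
  shows "eqcut A1 A2 (\<lambda>_. True) cutR IP IQ (\<lambda>_ r2. r2 = s) t (Ret s)"
  using assms by induction (auto intro: eqcut_Ret eqcut_CutL eqcut_TauL)


section \<open>Validity of command judgments\<close>

declare split_paired_All [simp del]

definition err_event :: "('f, 'mem, 'val, 'err) cmd_event \<Rightarrow> bool" where
  "err_event e \<longleftrightarrow> (\<exists>x. e = ErrE x)"

lemma err_event_simps [simp]:
  "\<not> err_event (Inl c)" "err_event (ErrE x)" "\<not> err_event (RndE n)"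
  by (simp_all add: err_event_def)

abbreviation eqcut_cmd where
  "eqcut_cmd \<equiv> eqcut cmd_answers cmd_answers err_event (\<lambda>_. False)"

abbreviation no_err :: "('f, 'mem, 'val, 'err) cmd_pre \<Rightarrow> ('f, 'mem, 'val, 'err) cmd_pre" where
  "no_err IP \<equiv> (\<lambda>e1 e2. IP e1 e2 \<and> \<not> err_event e2)"

text \<open>Stated on call trees, so that calls stay opaque events during the induction over
  derivations. Since \<open>no_err IP\<close> implies \<open>IP\<close>, \<open>eqcut_mono\<close>
  recovers the intended contract.\<close>

definition cmd_valid ::
  "('expr, 'lval, 'mem, 'var, 'val, 'err) lang
     \<Rightarrow> ('f, 'mem, 'val, 'err) cmd_pre \<Rightarrow> ('f, 'mem, 'val, 'err) cmd_post
     \<Rightarrow> ('expr, 'lval, 'f) cmd \<Rightarrow> ('expr, 'lval, 'f) cmd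
     \<Rightarrow> ('mem, 'var, 'val) srel \<Rightarrow> ('mem, 'var, 'val) srel \<Rightarrow> bool" where
  "cmd_valid L IP IQ c1 c2 \<Phi> \<Psi> \<longleftrightarrow>
     (\<forall>\<sigma>1 \<sigma>2. \<Phi> \<sigma>1 \<sigma>2 \<longrightarrow> eqcut_cmd (no_err IP) IQ \<Psi> (call_sem L c1 \<sigma>1) (call_sem L c2 \<sigma>2))"

section \<open>Expressions, left-values and triggered events\<close>

lemma embed_simps:
  "embed ev an (Ret r) = Ret r"
  "embed ev an (Tau t) = Tau (embed ev an t)"
  "embed ev an (Vis e h) = Vis (ev e) (\<lambda>a. embed ev an (h (an a)))"
  by (subst embed.code; simp)+

text \<open>Left errors are cutoffs before and after embedding, and no events are ever matched, so
  every contract is respected.\<close>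

lemma eqcut_lift_err:
  assumes "eqcut_err \<phi> t1 t2"
  shows "eqcut_cmd IP IQ \<phi> (lift_err t1) (lift_err t2)"
  using assms
proof (coinduction arbitrary: t1 t2 rule: eqcut_coinduct)
  case step
  then have "eqcut_step err_answers err_answers (\<lambda>_. True) (\<lambda>_. False) (\<lambda>_ _. False) (\<lambda>_ _. False)
      \<phi> (eqcut_err \<phi>) t1 t2"
    unfolding eqcut_err_def by (simp only: eqcut_unfold[symmetric])
  then show ?case
    unfolding lift_err_def
    by induction (auto simp: embed_simps intro!: eqcut_step.Tau
        intro: eqcut_step.Ret eqcut_step.TauL eqcut_step.TauR eqcut_step.CutL)
qed

lemma eqcut_eval:
  assumes "expr_valid L e1 e2 \<Phi> \<psi>" "\<Phi> \<sigma>1 \<sigma>2"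
  shows "eqcut_cmd IP IQ \<psi> (lift_err (eval L e1 \<sigma>1)) (lift_err (eval L e2 \<sigma>2))"
  using assms by (auto simp: expr_valid_def intro: eqcut_lift_err)

lemma eqcut_put:
  assumes "lval_valid L l1 l2 \<Phi> \<phi> \<Psi>" "\<Phi> \<sigma>1 \<sigma>2" "\<phi> v1 v2"
  shows "eqcut_cmd IP IQ \<Psi> (lift_err (put L l1 v1 \<sigma>1)) (lift_err (put L l2 v2 \<sigma>2))"
  using assms by (auto simp: lval_valid_def intro: eqcut_lift_err)

text \<open>If the common value is no truth value, both sides raise a type error and the left one is
  a cutoff. The guard comes from \<open>eqcut_result\<close>.\<close>

lemma eqcut_eval_bool:
  assumes "expr_valid L e1 e2 \<Phi> (=)" "\<Phi> \<sigma>1 \<sigma>2"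
  shows "eqcut_cmd IP IQ (\<lambda>b1 b2. b1 = b2 \<and> guard L e1 b1 \<sigma>1 \<sigma>2)
    (lift_err (eval_bool L e1 \<sigma>1)) (lift_err (eval_bool L e2 \<sigma>2))"
proof (rule eqcut_lift_err)
  have "eqcut_err (=) (eval L e1 \<sigma>1) (eval L e2 \<sigma>2)"
    using assms by (auto simp: expr_valid_def)
  then have "eqcut_err (=) (eval_bool L e1 \<sigma>1) (eval_bool L e2 \<sigma>2)"
    unfolding eqcut_err_def eval_bool_def
    by (rule eqcut_bind)
      (auto simp: val_of_option_def throw_def split: option.split intro: eqcut_Ret eqcut_CutL)
  then show "eqcut_err (\<lambda>b1 b2. b1 = b2 \<and> guard L e1 b1 \<sigma>1 \<sigma>2)
      (eval_bool L e1 \<sigma>1) (eval_bool L e2 \<sigma>2)"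
    unfolding eqcut_err_def guard_def by (rule eqcut_result)
qed

lemma eqcut_eval_size:
  assumes "expr_valid L e1 e2 \<Phi> (rnd_pre L IP)" "\<Phi> \<sigma>1 \<sigma>2"
  shows "eqcut_cmd IP' IQ' (\<lambda>n1 n2. IP (RndE n1) (RndE n2))
    (lift_err (eval_size L e1 \<sigma>1)) (lift_err (eval_size L e2 \<sigma>2))"
proof (rule eqcut_lift_err)
  have "eqcut_err (rnd_pre L IP) (eval L e1 \<sigma>1) (eval L e2 \<sigma>2)"
    using assms by (auto simp: expr_valid_def)
  then show "eqcut_err (\<lambda>n1 n2. IP (RndE n1) (RndE n2)) (eval_size L e1 \<sigma>1) (eval_size L e2 \<sigma>2)"
    unfolding eqcut_err_def eval_size_def
    by (rule eqcut_bind) (auto simp: rnd_pre_def val_of_option_def intro: eqcut_Ret)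
qed

text \<open>The answer sets in the \<open>Vis\<close> rule supply the lengths that
  \<open>rnd_post\<close> requires, with \<open>n1\<close> and \<open>n2\<close> as its
  witnesses.\<close>

lemma eqcut_trigger_rnd:
  assumes "IP (RndE n1) (RndE n2)"
  shows "eqcut_cmd (no_err IP) IQ
    (\<lambda>a1 a2. rnd_post L IP IQ (bytes_val L a1) (bytes_val L a2)) (trigger_rnd n1) (trigger_rnd n2)"
  unfolding trigger_rnd_def trigger_def bind_simps
  by (rule eqcut_Vis)
    (use assms in \<open>auto simp: cmd_answers_def ext_answers_def rnd_post_def intro!: eqcut_Ret, blast\<close>)

lemma eqcut_trigger_call:
  assumes "IP (CallE f m1 v1) (CallE g m2 v2)"
    and "\<And>m1' v1' m2' v2'. IQ (CallE f m1 v1, CallA m1' v1') (CallE g m2 v2, CallA m2' v2')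
      \<Longrightarrow> \<phi> (m1', v1') (m2', v2')"
  shows "eqcut_cmd (no_err IP) IQ \<phi> (trigger_call f m1 v1) (trigger_call g m2 v2)"
  unfolding trigger_call_def trigger_def bind_simps
  by (rule eqcut_Vis) (use assms in \<open>auto simp: cmd_answers_def intro!: eqcut_Ret\<close>)

section \<open>Soundness of the rules\<close>

text \<open>A halting assignment either fails, which is a cutoff, or returns a state that
  \<open>eqcut_result\<close> shows to be its outcome, so that \<open>post\<close> applies.\<close>

lemma cmd_valid_AssignL:
  fixes L :: "('expr, 'lval, 'mem, 'var, 'val, 'err) lang" and IP :: "('f, 'mem, 'val, 'err) cmd_pre"
  assumes L: "halting_lang L"
    and post: "\<And>\<sigma>1 \<sigma>1' \<sigma>2. \<Phi> \<sigma>1 \<sigma>2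
        \<Longrightarrow> weak_bisim cmd_answers
              (call_sem L (Assign l e) \<sigma>1 :: ('f, 'mem, 'val, 'err, ('mem, 'var, 'val) state) cmd_tree)
              (Ret \<sigma>1')
        \<Longrightarrow> \<Psi> \<sigma>1' \<sigma>2"
  shows "cmd_valid L IP IQ (Assign l e) Skip \<Phi> \<Psi>"
  unfolding cmd_valid_def
proof (intro allI impI)
  fix \<sigma>1 \<sigma>2
  assume \<Phi>: "\<Phi> \<sigma>1 \<sigma>2"
  \<comment> \<open>\<open>Skip\<close> is presented as two successive returns, giving evaluation
    and writing one counterpart each; for now only the right state is tracked.\<close>
  have "eqcut_cmd (\<lambda>_ _. False) IQ (\<lambda>_ \<sigma>. \<sigma> = \<sigma>2)
      (bind (lift_err (eval L e \<sigma>1)) (\<lambda>v. lift_err (put L l v \<sigma>1)))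
      (bind (lift_err (Ret \<sigma>2)) (\<lambda>\<sigma>. lift_err (Ret \<sigma>)))"
    using L by (intro eqcut_bind[where \<phi> = "\<lambda>_ \<sigma>. \<sigma> = \<sigma>2"] eqcut_lift_err)
      (auto simp: halting_lang_def eqcut_err_def intro: halts_eqcut_Ret)
  then have "eqcut_cmd (\<lambda>_ _. False) IQ (\<lambda>_ \<sigma>. \<sigma> = \<sigma>2) (call_sem L (Assign l e) \<sigma>1)
      (call_sem L Skip \<sigma>2)"
    by (simp add: lift_err_def embed_simps)
  from eqcut_result[OF this, of cmd_answers] \<Phi> post
  show "eqcut_cmd (no_err IP) IQ \<Psi> (call_sem L (Assign l e) \<sigma>1) (call_sem L Skip \<sigma>2)"
    by (elim eqcut_mono) auto
qed

text \<open>\<open>\<Phi>\<close> is the invariant. The negated guard holds at exit because the exit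
  branch returns the very state in which the guard was evaluated.\<close>

lemma cmd_valid_While:
  assumes e: "expr_valid L e1 e2 \<Phi> (=)"
    and c: "cmd_valid L IP IQ c1 c2 (\<lambda>\<sigma>1 \<sigma>2. \<Phi> \<sigma>1 \<sigma>2 \<and> guard L e1 True \<sigma>1 \<sigma>2) \<Phi>"
  shows "cmd_valid L IP IQ (While e1 c1) (While e2 c2)
    \<Phi> (\<lambda>\<sigma>1 \<sigma>2. \<Phi> \<sigma>1 \<sigma>2 \<and> guard L e1 False \<sigma>1 \<sigma>2)"
  unfolding cmd_valid_def call_sem.simps
proof (intro allI impI)
  fix \<sigma>1 \<sigma>2
  assume "\<Phi> \<sigma>1 \<sigma>2"
  then show "eqcut_cmd (no_err IP) IQ (\<lambda>\<sigma>1 \<sigma>2. \<Phi> \<sigma>1 \<sigma>2 \<and> guard L e1 False \<sigma>1 \<sigma>2)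
     (iter (\<lambda>\<sigma>. bind (lift_err (eval_bool L e1 \<sigma>))
        (\<lambda>b. if b then bind (call_sem L c1 \<sigma>) (\<lambda>\<sigma>'. Ret (Inl \<sigma>')) else Ret (Inr \<sigma>))) \<sigma>1)
     (iter (\<lambda>\<sigma>. bind (lift_err (eval_bool L e2 \<sigma>))
        (\<lambda>b. if b then bind (call_sem L c2 \<sigma>) (\<lambda>\<sigma>'. Ret (Inl \<sigma>')) else Ret (Inr \<sigma>))) \<sigma>2)"
  proof (rule eqcut_iter[where R = \<Phi>, rotated], goal_cases)
    case (1 \<sigma>1 \<sigma>2)
    from eqcut_eval_bool[OF e 1] show ?case
    proof (rule eqcut_bind)
      fix b1 b2
      assume b: "b1 = b2 \<and> guard L e1 b1 \<sigma>1 \<sigma>2"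
      have "eqcut_cmd (no_err IP) IQ \<Phi> (call_sem L c1 \<sigma>1) (call_sem L c2 \<sigma>2)" if b1
        using c 1 b that by (auto simp: cmd_valid_def)
      then show "eqcut_cmd (no_err IP) IQ
          (rel_sum \<Phi> (\<lambda>\<sigma>1 \<sigma>2. \<Phi> \<sigma>1 \<sigma>2 \<and> guard L e1 False \<sigma>1 \<sigma>2))
          (if b1 then bind (call_sem L c1 \<sigma>1) (\<lambda>\<sigma>'. Ret (Inl \<sigma>')) else Ret (Inr \<sigma>1))
          (if b2 then bind (call_sem L c2 \<sigma>2) (\<lambda>\<sigma>'. Ret (Inl \<sigma>')) else Ret (Inr \<sigma>2))"
        using 1 b by (auto intro!: eqcut_Ret eqcut_bind[where \<phi> = \<Phi>])
    qed
  qed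
qed

text \<open>\<open>no_err IP1\<close> discharges the cutoff condition of \<open>eqcut_trans\<close>,
  and \<open>post_comp\<close> provides the linking answer at each middle event.\<close>

lemma cmd_valid_Trans:
  assumes "cmd_valid L IP1 IQ1 c1 c2 \<Phi>1 \<Psi>1" "cmd_valid L IP2 IQ2 c2 c3 \<Phi>2 \<Psi>2"
  shows "cmd_valid L (IP1 OO IP2) (post_comp cmd_answers IP1 IP2 IQ1 IQ2) c1 c3
    (\<Phi>1 OO \<Phi>2) (\<Psi>1 OO \<Psi>2)"
  unfolding cmd_valid_def
proof (intro allI impI, elim relcomppE)
  fix \<sigma>1 \<sigma>2 \<sigma>3
  assume "\<Phi>1 \<sigma>1 \<sigma>2" "\<Phi>2 \<sigma>2 \<sigma>3"
  with assms have "eqcut_cmd (no_err IP1) IQ1 \<Psi>1 (call_sem L c1 \<sigma>1) (call_sem L c2 \<sigma>2)"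
    and "eqcut_cmd (no_err IP2) IQ2 \<Psi>2 (call_sem L c2 \<sigma>2) (call_sem L c3 \<sigma>3)"
    by (auto simp: cmd_valid_def)
  then have "eqcut_cmd (no_err IP1 OO no_err IP2) (post_comp cmd_answers IP1 IP2 IQ1 IQ2)
      (\<Psi>1 OO \<Psi>2) (call_sem L c1 \<sigma>1) (call_sem L c3 \<sigma>3)"
    by (rule eqcut_trans) (auto simp: post_comp_def)
  then show "eqcut_cmd (no_err (IP1 OO IP2)) (post_comp cmd_answers IP1 IP2 IQ1 IQ2)
      (\<Psi>1 OO \<Psi>2) (call_sem L c1 \<sigma>1) (call_sem L c3 \<sigma>3)"
    by (rule eqcut_mono) auto
qed

text \<open>\<open>halting_lang\<close> enters at the one-sided assignment, where the right side is
  already finished.\<close>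

lemma hoare_sound:
  assumes "halting_lang L" "hoare L IP IQ c1 c2 \<Phi> \<Psi>"
  shows "cmd_valid L IP IQ c1 c2 \<Phi> \<Psi>"
  using assms(2)
proof induction
  case (Skip IP IQ \<Phi>)
  then show ?case
    by (auto simp: cmd_valid_def intro: eqcut_Ret)
next
  case (Seq IP IQ c1 c2 \<Phi> \<Phi>' c1' c2' \<Phi>'')
  then show ?case
    unfolding cmd_valid_def call_sem.simps by (blast intro: eqcut_bind)
next
  case (Assign e1 e2 \<Phi> \<phi> l1 l2 \<Psi> IP IQ)
  then show ?case
    by (auto simp: cmd_valid_def intro!: eqcut_bind[OF eqcut_eval] eqcut_put)
next
  case (Case e1 e2 \<Phi> IP IQ c1 c2 \<Psi> c1' c2')
  then show ?case
    by (auto simp: cmd_valid_def intro!: eqcut_bind[OF eqcut_eval_bool])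
next
  case (While e1 e2 \<Phi> IP IQ c1 c2)
  then show ?case
    by (intro cmd_valid_While)
next
  case (Rand e1 e2 \<Phi> IP l1 l2 IQ \<Psi>)
  then show ?case
    by (auto simp: cmd_valid_def
        intro!: eqcut_bind[OF eqcut_eval_size] eqcut_bind[OF eqcut_trigger_rnd] eqcut_put)
next
  case (Call IP IQ f g IPm IPv IQm IQv e1 e2 \<Phi>r l1 l2 \<Psi>)
  show ?case
    unfolding cmd_valid_def call_sem.simps
  proof (intro allI impI)
    fix \<sigma>1 \<sigma>2
    assume \<Phi>: "srel_of \<Phi>r IPm \<sigma>1 \<sigma>2"
    show "eqcut_cmd (no_err IP) IQ \<Psi>
        (bind (lift_err (eval L e1 \<sigma>1)) (\<lambda>v. bind (trigger_call f (fst \<sigma>1) v)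
          (\<lambda>(m', v'). lift_err (put L l1 v' (m', snd \<sigma>1)))))
        (bind (lift_err (eval L e2 \<sigma>2)) (\<lambda>v. bind (trigger_call g (fst \<sigma>2) v)
          (\<lambda>(m', v'). lift_err (put L l2 v' (m', snd \<sigma>2)))))"
    proof (rule eqcut_bind[OF eqcut_eval[OF Call(2) \<Phi>]])
      fix v1 v2
      assume "IPv v1 v2"
      with Call(1) \<Phi> have "eqcut_cmd (no_err IP) IQ (\<lambda>(m1, v1) (m2, v2). IQm m1 m2 \<and> IQv v1 v2)
          (trigger_call f (fst \<sigma>1) v1) (trigger_call g (fst \<sigma>2) v2)"
        by (intro eqcut_trigger_call) (auto simp: split_contract_def srel_of_def)
      then show "eqcut_cmd (no_err IP) IQ \<Psi>
          (bind (trigger_call f (fst \<sigma>1) v1) (\<lambda>(m', v'). lift_err (put L l1 v' (m', snd \<sigma>1))))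
          (bind (trigger_call g (fst \<sigma>2) v2) (\<lambda>(m', v'). lift_err (put L l2 v' (m', snd \<sigma>2))))"
        \<comment> \<open>The call leaves the variable maps untouched, so \<open>\<Phi>r\<close>
          persists and combines with \<open>IQm\<close> on the new memories.\<close>
        by (rule eqcut_bind) (use \<Phi> in \<open>auto intro!: eqcut_put[OF Call(3)] simp: srel_of_def\<close>)
    qed
  qed
next
  case (AssignL \<Phi> l e \<Psi> IP IQ)
  then show ?case
    using assms(1) by (intro cmd_valid_AssignL)
next
  case (Conseq IP' IQ' c1 c2 \<Phi>' \<Psi>' \<Phi> \<Psi> IP IQ)
  then show ?case
    unfolding cmd_valid_def post_le_def
    by (blast intro: eqcut_mono)
next
  case (Trans IP1 IQ1 c1 c2 \<Phi>1 \<Psi>1 IP2 IQ2 c3 \<Phi>2 \<Psi>2)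
  then show ?case
    by (intro cmd_valid_Trans)
qed

section \<open>From command judgments to programs\<close>

theorem theorem5p3:
  fixes L :: "('expr, 'lval, 'mem, 'var, 'val, 'err) lang"
    and P1 P2 :: "('expr, 'lval, 'f, 'var) program"
    and IP :: "'err ext_pre" and IQ :: "'err ext_post"
    and \<Phi> \<Psi> :: "'f \<Rightarrow> 'f \<Rightarrow> ('mem, 'var, 'val) srel"
  assumes "halting_lang L"
    and "prog_hoare L IP IQ P1 P2 \<Phi> \<Psi>"
  shows "prog_valid L IP IQ P1 P2 \<Phi> \<Psi>"
  unfolding prog_valid_def
proof (intro allI impI)
  let ?IP = "no_err (pre_union L P1 P2 IP \<Phi>)" and ?IQ = "post_union P1 P2 IQ \<Psi>"
  \<comment> \<open>Serves twice: for the bodies under comparison and for the handlers of the calls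
    they make.\<close>
  have body: "eqcut_cmd ?IP ?IQ (\<Psi> f g) (call_sem L (f_body F) \<sigma>1) (call_sem L (f_body G) \<sigma>2)"
    if "P1 f = Some F" "P2 g = Some G" "\<Phi> f g \<sigma>1 \<sigma>2" for f g F G \<sigma>1 \<sigma>2
    using assms(2)
  proof cases
    case Rec
    with that hoare_sound[OF assms(1)] show ?thesis
      unfolding cmd_valid_def by blast
  qed
  fix f g F G \<sigma>1 \<sigma>2
  assume "P1 f = Some F" "P2 g = Some G" "\<Phi> f g \<sigma>1 \<sigma>2"
  then have "eqcut_cmd ?IP ?IQ (\<Psi> f g) (call_sem L (f_body F) \<sigma>1) (call_sem L (f_body G) \<sigma>2)"
    by (rule body)
  then have "eqcut ext_answers ext_answers (\<lambda>e. err_event (Inr e :: ('f, 'mem, 'val, 'err) cmd_event))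
      (\<lambda>_. False) (\<lambda>e1 e2. ?IP (Inr e1) (Inr e2))
      (\<lambda>(e1, a1) (e2, a2). ?IQ (Inr e1, Inr a1) (Inr e2, Inr a2)) (\<Psi> f g)
      (sem L P1 (f_body F) \<sigma>1) (sem L P2 (f_body G) \<sigma>2)"
    unfolding sem_def cmd_answers_def
  proof (rule eqcut_interp_mrec, fold cmd_answers_def, goal_cases)
    case (1 e1 e2)
    then show ?case
      by (cases e1; cases e2) auto
  next
    case (4 e1 e2)
    obtain f' m1 v1 where e1: "e1 = (f', m1, v1)"
      by (cases e1)
    obtain g' m2 v2 where e2: "e2 = (g', m2, v2)"
      by (cases e2)
    \<comment> \<open>\<open>pre_union\<close> yields both functions and related initial states, so
      \<open>body\<close> applies; the final states are the witnesses for
      \<open>post_union\<close>.\<close>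
    from 4 obtain F' G' where F': "P1 f' = Some F'" and G': "P2 g' = Some G'"
      and "\<Phi> f' g' (init_state L F' m1 v1) (init_state L G' m2 v2)"
      by (auto simp: e1 e2)
    from body[OF this] show ?case
      unfolding e1 e2 call_handler.simps F' G' option.case
      by (rule eqcut_bind) (use F' G' in \<open>auto intro!: eqcut_Ret simp: call_answers_def, blast\<close>)
  qed auto
  moreover have "err_event (Inr e :: ('f, 'mem, 'val, 'err) cmd_event) = isl e" for e
    by (cases e) auto
  ultimately show "eqcut ext_answers ext_answers isl (\<lambda>_. False) IP IQ (\<Psi> f g)
      (sem L P1 (f_body F) \<sigma>1) (sem L P2 (f_body G) \<sigma>2)"
    by (simp, elim eqcut_mono) auto
qed

end
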